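(* Let $(p_m)_{m\ge 0}$ be a critical offspring distribution with finite third moment and let $D$ be a step distribution on $\mathbb{Z}^d$ as in the context. For every $m\ge 0$ and every possible realisation $C$ of the embedded tree $(T,\phi)_m$ up to generation $m$, the limits $$\mathbb{P}_{\infty}^{\rm brw}(C)=\lim_{n\to\infty}\mathbb{P}_n^{\rm brw}(C),\qquad \mathbb{Q}_{\infty}^{\rm brw}(C)=\lim_{n\to\infty}\mathbb{Q}_n^{\rm brw}(C)$$ exist, they define probability measures $\mathbb{P}_\infty^{\rm brw}$ and $\mathbb{Q}_\infty^{\rm brw}$ on the $\sigma$-algebra generated by the cylinder events $\{(T,\phi)_m=C\}$ (over all $m$ and $C$), and $\mathbb{P}_{\infty}^{\rm brw}=\mathbb{Q}_{\infty}^{\rm brw}$.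
   Context: Offspring distribution: $(p_m)_{m\ge0}$ is a probability distribution on $\{0,1,2,\dots\}$ with $\sum_m m p_m=1$, $\sigma_p^2=\sum_m m(m-1)p_m<\infty$, and finite third moment. Trees: $T$ is the Galton--Watson family tree started from one individual with offspring law $(p_m)$; individuals are words: the root is the word $0$, the children of a word $i$ with $\xi_i$ offspring are the words $i1,i2,\dots,i\xi_i$. Two trees are equal iff they have the same set of words. Numbers of offspring of distinct individuals are independent, so a finite tree $T$ has probability $\prod_{i\in T}p_{\xi_i}$. $|i|$ denotes the generation (graph distance to the root) of $i\in T$. Embedding: $D:\mathbb{Z}^d\to[0,1]$ is a probability distribution with $D(x)=D(-x)$, $\sigma^2=\sum_x|x|^2D(x)<\infty$, and $\sum_x|x|^{2+2\delta}D(x)<\infty$ for some $\delta\in(0,1)$. Given $T$, the random map $\phi:T\to\mathbb{Z}^d$ sends the root to the origin, and independently for each child $j$ of $i$ the displacement $\phi(j)-\phi(i)$ has law $D$. The joint law of $(T,\phi)$ is $\mathbb{P}^{\rm brw}$ (branching random walk), with expectation $\mathbb{E}^{\rm brw}$. $T_m=\{i\in T:|i|\le m\}$, and $(T,\phi)_m$ is the embedding of $T_m$, i.e. $T_m$ together with $\phi$ restricted to $T_m$. $N_n=\#\{i\in T:|i|=n\}$. For a realisation $C$ of the embedded tree up to generation $m$ and $n\ge m$: $$\mathbb{P}_n^{\rm brw}(C)=\sum_{x\in\mathbb{Z}^d}\ \sum_{i:|i|=n}\mathbb{P}^{\rm brw}\big((T,\phi)_m=C,\ i\in T,\ \phi(i)=x\big)=\mathbb{E}^{\rm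 brw}\big(N_n I[(T,\phi)_m=C]\big),$$ $$\mathbb{Q}_n^{\rm brw}(C)=\mathbb{P}^{\rm brw}\big((T,\phi)_m=C\ \big|\ \exists i\in T:|i|=n\big).$$ $I[E]$ denotes the indicator of $E$. *)

theory Defs
  imports "HOL-Probability.Probability"
begin

(* Individuals are words: the root is the word 0 and the children of i are the words i1, i2, ...
   Only words starting with the letter 0 are ever individuals of a tree. *)
type_synonym word = "nat list"

definition root_word :: word where
  "root_word = [0]"

definition generation :: "word \<Rightarrow> nat" where
  "generation i = length i - 1"

inductive_set family_tree :: "(word \<Rightarrow> nat) \<Rightarrow> word set" for \<xi> :: "word \<Rightarrow> nat" where
  root: "root_word \<in> family_tree \<xi>"
| child: "i \<in> family_tree \<xi> \<Longrightarrow> 1 \<le> k \<Longrightarrow> k \<le> \<xi> i \<Longrightarrow> i @ [k] \<in> family_tree \<xi>"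

(* The lattice of dimension d = CARD('d) is int ^ 'd. An embedded tree is a pair (T, phi); phi is
   kept undefined outside T, so that two embedded trees are equal iff they have the same words
   and the same embedding. *)
type_synonym 'd etree = "word set \<times> (word \<Rightarrow> int ^ 'd)"

definition embedded_trees :: "('d::finite) etree set" where
  "embedded_trees = {(T, \<phi>). (\<exists>\<xi>. T = family_tree \<xi>) \<and> \<phi> \<in> extensional T \<and> \<phi> root_word = 0}"

definition truncate :: "nat \<Rightarrow> ('d::finite) etree \<Rightarrow> 'd etree" where
  "truncate m = (\<lambda>(T, \<phi>). let T' = {i \<in> T. generation i \<le> m} in (T', restrict \<phi> T'))"

definition realisations :: "nat \<Rightarrow> ('d::finite) etree set" where
  "realisations m = truncate m ` embedded_trees"

definition cylinder :: "nat \<Rightarrow> ('d::finite) etree \<Rightarrow> 'd etree set" where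
  "cylinder m C = {t \<in> embedded_trees. truncate m t = C}"

definition etree_space :: "('d::finite) etree measure" where
  "etree_space = sigma embedded_trees {cylinder m C | m C. C \<in> realisations m}"

(* The words take l i with 2 <= l <= length i are i and its ancestors other than the root;
   \<Delta> j is the displacement of j from its parent. *)
definition position :: "(word \<Rightarrow> int ^ 'd) \<Rightarrow> word \<Rightarrow> int ^ ('d::finite)" where
  "position \<Delta> i = (\<Sum>l = 2..length i. \<Delta> (take l i))"

definition embed_tree :: "(word \<Rightarrow> nat \<times> (int ^ 'd)) \<Rightarrow> ('d::finite) etree" where
  "embed_tree \<omega> = (let T = family_tree (\<lambda>i. fst (\<omega> i))
                   in (T, restrict (position (\<lambda>i. snd (\<omega> i))) T))"

(* Every word, whether or not it turns out to be an individual, independently receives a number of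
   offspring of law p and an independent displacement of law D. *)
definition brw :: "nat pmf \<Rightarrow> (int ^ 'd) pmf \<Rightarrow> ('d::finite) etree measure" where
  "brw p D = distr (Pi\<^sub>M UNIV (\<lambda>_::word. measure_pmf (pair_pmf p D))) etree_space embed_tree"

definition P_n :: "nat pmf \<Rightarrow> (int ^ 'd) pmf \<Rightarrow> nat \<Rightarrow> nat \<Rightarrow> ('d::finite) etree \<Rightarrow> real" where
  "P_n p D n m C = (\<Sum>\<^sub>\<infinity>x. \<Sum>\<^sub>\<infinity>i\<in>{i. generation i = n}.
     \<P>(t in brw p D. truncate m t = C \<and> i \<in> fst t \<and> snd t i = x))"

definition Q_n :: "nat pmf \<Rightarrow> (int ^ 'd) pmf \<Rightarrow> nat \<Rightarrow> nat \<Rightarrow> ('d::finite) etree \<Rightarrow> real" where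
  "Q_n p D n m C = \<P>(t in brw p D. truncate m t = C \<bar> \<exists>i\<in>fst t. generation i = n)"

definition P_infinity :: "nat pmf \<Rightarrow> (int ^ 'd) pmf \<Rightarrow> nat \<Rightarrow> ('d::finite) etree \<Rightarrow> real" where
  "P_infinity p D m C = lim (\<lambda>n. P_n p D n m C)"

definition Q_infinity :: "nat pmf \<Rightarrow> (int ^ 'd) pmf \<Rightarrow> nat \<Rightarrow> ('d::finite) etree \<Rightarrow> real" where
  "Q_infinity p D m C = lim (\<lambda>n. Q_n p D n m C)"

definition prob_with_cylinders ::
    "(nat \<Rightarrow> ('d::finite) etree \<Rightarrow> real) \<Rightarrow> 'd etree measure \<Rightarrow> bool" where
  "prob_with_cylinders F \<mu> \<longleftrightarrow> prob_space \<mu> \<and> sets \<mu> = sets etree_space \<and>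
     (\<forall>m. \<forall>C\<in>realisations m. measure \<mu> (cylinder m C) = F m C)"

definition lattice_norm :: "int ^ 'd \<Rightarrow> real" where
  "lattice_norm x = norm (\<chi> k. real_of_int (x $ k))"

end

theory Submission
  imports Defs
begin

text \<open>Write \<open>N\<^sub>m(C)\<close> for the number of individuals of generation \<open>m\<close> in a realisation \<open>C\<close>. Given that the
  embedded tree up to generation \<open>n\<close> is \<open>C\<close>, generation \<open>n + 1\<close> is a sum of \<open>N\<^sub>n(C)\<close> independent
  offspring numbers. Hence the size of generation \<open>n\<close> is a martingale, and \<open>P_n\<close> of a cylinder of
  depth \<open>m\<close> is \<open>N\<^sub>m(C) P(C)\<close> for every \<open>n \<ge> m\<close>. With \<open>\<theta>\<^sub>n\<close> the probability of surviving up to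
  generation \<open>n\<close>, iterating generating functions gives
  \<open>Q_n(C) = (1 - (1 - \<theta>\<^bsub>n-m\<^esub>)^N\<^sub>m(C)) P(C) / \<theta>\<^sub>n\<close>. In the critical case with \<open>p\<^sub>1 \<noteq> 1\<close> we have \<open>\<theta>\<^sub>n \<rightarrow> 0\<close> and
  \<open>\<theta>\<^bsub>n+1\<^esub> / \<theta>\<^sub>n \<rightarrow> 1\<close>, so the limit is again \<open>N\<^sub>m(C) P(C)\<close>; if \<open>p\<^sub>1 = 1\<close> then \<open>N\<^sub>m = 1\<close> almost surely. These
  numbers form a consistent family of discrete probability distributions, so they extend to a
  measure on embedded trees, unique because the cylinders are stable under intersection.\<close>

section \<open>Family trees and their truncations\<close>

lemma Nil_notin_family_tree [simp]: "[] \<notin> family_tree \<xi>"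
  by (auto elim: family_tree.cases simp: root_word_def)

text \<open>The inductive rules inverted at the last letter: the root is \<open>[] @ [0]\<close>,
  every other individual extends its parent. Membership becomes a recursion on words read from the
  right, so proofs about trees can proceed by \<open>rev_induct\<close>.\<close>

lemma snoc_mem_family_tree_iff:
  "i @ [k] \<in> family_tree \<xi> \<longleftrightarrow>
     i = [] \<and> k = 0 \<or> i \<in> family_tree \<xi> \<and> 1 \<le> k \<and> k \<le> \<xi> i"
proof
  assume "i @ [k] \<in> family_tree \<xi>"
  then show "i = [] \<and> k = 0 \<or> i \<in> family_tree \<xi> \<and> 1 \<le> k \<and> k \<le> \<xi> i"
    by cases (auto simp: root_word_def)
qed (use family_tree.root[of \<xi>] in \<open>auto simp: root_word_def intro: family_tree.child\<close>)

text \<open>The recursion determines the set, by induction on the word. Truncations, and unions of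
  increasing trees, are recognised as family trees in this way.\<close>

lemma family_tree_eqI:
  assumes "\<And>i k. i @ [k] \<in> T \<longleftrightarrow> i = [] \<and> k = 0 \<or> i \<in> T \<and> 1 \<le> k \<and> k \<le> \<xi> i"
    and "[] \<notin> T"
  shows "T = family_tree \<xi>"
proof -
  have "i \<in> T \<longleftrightarrow> i \<in> family_tree \<xi>" for i
    by (induction i rule: rev_induct) (use assms in \<open>auto simp: snoc_mem_family_tree_iff\<close>)
  then show ?thesis by blast
qed

lemma generation_snoc [simp]: "generation (i @ [k]) = length i"
  by (simp add: generation_def)

lemma generation_root [simp]: "generation root_word = 0"
  by (simp add: generation_def root_word_def)

lemma length_family_tree: "i \<in> family_tree \<xi> \<Longrightarrow> length i = Suc (generation i)"
  by (cases i rule: rev_cases) auto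

lemma family_tree_children: "i \<in> family_tree \<xi> \<Longrightarrow> {k. i @ [k] \<in> family_tree \<xi>} = {1..\<xi> i}"
  by (auto simp: snoc_mem_family_tree_iff)

lemma finite_family_tree_generation: "finite {i \<in> family_tree \<xi>. generation i = n}"
proof (induction n)
  case 0
  have "{i \<in> family_tree \<xi>. generation i = 0} \<subseteq> {root_word}"
  proof clarify
    fix i assume "i \<in> family_tree \<xi>" "generation i = 0"
    then show "i = root_word"
      by (cases i rule: rev_cases) (auto simp: snoc_mem_family_tree_iff root_word_def)
  qed
  then show ?case by (rule finite_subset) simp
next
  case (Suc n)
  let ?G = "{i \<in> family_tree \<xi>. generation i = n}"
  have "{i \<in> family_tree \<xi>. generation i = Suc n} \<subseteq> (\<Union>i\<in>?G. (\<lambda>k. i @ [k]) ` {1..\<xi> i})"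
  proof clarify
    fix i assume i: "i \<in> family_tree \<xi>" "generation i = Suc n"
    then obtain j k where "i = j @ [k]" by (cases i rule: rev_cases) auto
    with i length_family_tree[of j \<xi>] have "j \<in> ?G" "k \<in> {1..\<xi> j}" "i = j @ [k]"
      by (auto simp: snoc_mem_family_tree_iff)
    then show "i \<in> (\<Union>i\<in>?G. (\<lambda>k. i @ [k]) ` {1..\<xi> i})" by blast
  qed
  then show ?case by (rule finite_subset) (use Suc in auto)
qed

section \<open>Sizes of generations\<close>

definition num_gen :: "nat \<Rightarrow> word set \<Rightarrow> nat" where
  "num_gen n T = card {i \<in> T. generation i = n}"

lemma generation_0_iff: "i \<in> family_tree \<xi> \<and> generation i = 0 \<longleftrightarrow> i = root_word"
  by (cases i rule: rev_cases)
     (auto simp: snoc_mem_family_tree_iff root_word_def family_tree.root[unfolded root_word_def])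

lemma num_gen_0 [simp]: "num_gen 0 (family_tree \<xi>) = 1"
  by (simp add: num_gen_def generation_0_iff)

text \<open>A word of the next generation splits uniquely into its parent and a last letter, so that
  generation is the disjoint union of the sets of children.\<close>

lemma num_gen_Suc:
  "num_gen (Suc n) (family_tree \<xi>) = (\<Sum>i\<in>{i \<in> family_tree \<xi>. generation i = n}. \<xi> i)"
proof -
  let ?G = "{i \<in> family_tree \<xi>. generation i = n}"
  have "{i \<in> family_tree \<xi>. generation i = Suc n} = (\<lambda>(i, k). i @ [k]) ` Sigma ?G (\<lambda>i. {1..\<xi> i})"
  proof (intro equalityI subsetI)
    fix i assume "i \<in> {i \<in> family_tree \<xi>. generation i = Suc n}"
    then have i: "i \<in> family_tree \<xi>" "generation i = Suc n" by auto
    then obtain j k where "i = j @ [k]" by (cases i rule: rev_cases) auto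
    with i length_family_tree[of j \<xi>] have "j \<in> ?G" "k \<in> {1..\<xi> j}" "i = j @ [k]"
      by (auto simp: snoc_mem_family_tree_iff)
    then show "i \<in> (\<lambda>(i, k). i @ [k]) ` Sigma ?G (\<lambda>i. {1..\<xi> i})" by auto
  qed (auto simp: snoc_mem_family_tree_iff dest: length_family_tree)
  moreover have "inj_on (\<lambda>(i, k). i @ [k]) (Sigma ?G (\<lambda>i. {1..\<xi> i}))"
    by (auto simp: inj_on_def)
  ultimately show ?thesis
    unfolding num_gen_def using finite_family_tree_generation
    by (simp add: card_image card_SigmaI)
qed

section \<open>Truncations and realisations\<close>

lemma truncate_Pair:
  "truncate m (T, \<phi>) = ({i \<in> T. generation i \<le> m}, restrict \<phi> {i \<in> T. generation i \<le> m})"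
  by (simp add: truncate_def Let_def)

lemma fst_truncate: "fst (truncate m t) = {i \<in> fst t. generation i \<le> m}"
  by (cases t) (simp add: truncate_Pair)

lemma snd_truncate: "snd (truncate m t) = restrict (snd t) {i \<in> fst t. generation i \<le> m}"
  by (cases t) (simp add: truncate_Pair)

lemma truncate_truncate [simp]: "truncate m (truncate n t) = truncate (min m n) t"
  by (intro prod_eqI) (auto simp: fst_truncate snd_truncate restrict_def)

lemma num_gen_truncate: "n \<le> m \<Longrightarrow> num_gen n (fst (truncate m t)) = num_gen n (fst t)"
  unfolding num_gen_def by (rule arg_cong[of _ _ card]) (auto simp: fst_truncate)

text \<open>Cutting after generation \<open>m\<close> amounts to removing all offspring of
  generation \<open>m\<close>. Hence truncated trees are embedded trees again, and realisations are
  the embedded trees fixed by \<open>truncate m\<close>.\<close>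

lemma family_tree_truncate:
  "{i \<in> family_tree \<xi>. generation i \<le> m} = family_tree (\<lambda>i. if generation i < m then \<xi> i else 0)"
proof (rule family_tree_eqI)
  fix i k
  show "i @ [k] \<in> {i \<in> family_tree \<xi>. generation i \<le> m} \<longleftrightarrow> i = [] \<and> k = 0 \<or>
      i \<in> {i \<in> family_tree \<xi>. generation i \<le> m} \<and> 1 \<le> k \<and> k \<le> (if generation i < m then \<xi> i else 0)"
    using length_family_tree[of i \<xi>] by (auto simp: snoc_mem_family_tree_iff)
qed simp

lemma embedded_treesE:
  assumes "t \<in> embedded_trees"
  obtains \<xi> where "fst t = family_tree \<xi>" "snd t \<in> extensional (fst t)" "snd t root_word = 0"
  using assms by (auto simp: embedded_trees_def)

lemma embedded_treesI:
  "fst t = family_tree \<xi> \<Longrightarrow> snd t \<in> extensional (fst t) \<Longrightarrow> snd t root_word = 0 \<Longrightarrow> t \<in> embedded_trees"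
  by (cases t) (auto simp: embedded_trees_def)

lemma truncate_in_embedded_trees [intro]:
  assumes "t \<in> embedded_trees" shows "truncate m t \<in> embedded_trees"
proof -
  obtain \<xi> where \<xi>: "fst t = family_tree \<xi>" "snd t \<in> extensional (fst t)" "snd t root_word = 0"
    by (rule embedded_treesE[OF assms])
  have "fst (truncate m t) = family_tree (\<lambda>i. if generation i < m then \<xi> i else 0)"
    by (simp add: fst_truncate \<xi>(1) family_tree_truncate)
  moreover have "snd (truncate m t) root_word = 0"
    using \<xi> by (simp add: snd_truncate family_tree.root)
  moreover have "snd (truncate m t) \<in> extensional (fst (truncate m t))"
    by (simp add: fst_truncate snd_truncate)
  ultimately show ?thesis by (intro embedded_treesI)
qed

lemma realisations_iff: "C \<in> realisations m \<longleftrightarrow> C \<in> embedded_trees \<and> truncate m C = C"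
proof
  assume "C \<in> embedded_trees \<and> truncate m C = C"
  then show "C \<in> realisations m"
    unfolding realisations_def by (metis imageI)
qed (auto simp: realisations_def)

lemma realisations_mono: "m \<le> n \<Longrightarrow> realisations m \<subseteq> realisations n"
proof
  fix C assume "m \<le> n" "C \<in> realisations m"
  then have C: "C \<in> embedded_trees" "truncate m C = C" by (auto simp: realisations_iff)
  have "truncate n C = truncate n (truncate m C)" using C by simp
  also have "\<dots> = truncate m C" using \<open>m \<le> n\<close> by (simp add: min_absorb2)
  finally show "C \<in> realisations n" using C by (simp add: realisations_iff)
qed

lemma truncate_realisations: "t \<in> embedded_trees \<Longrightarrow> truncate m t \<in> realisations m"
  by (simp add: realisations_def)

lemma realisations_generation_le: "C \<in> realisations m \<Longrightarrow> i \<in> fst C \<Longrightarrow> generation i \<le> m"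
  by (metis (lifting) fst_truncate mem_Collect_eq realisations_iff)

lemma finite_realisation:
  assumes "C \<in> realisations m" shows "finite (fst C)"
proof -
  obtain \<xi> where "fst C = family_tree \<xi>"
    using assms by (auto simp: realisations_iff elim: embedded_treesE)
  then have "fst C = (\<Union>n\<le>m. {i \<in> family_tree \<xi>. generation i = n})"
    using realisations_generation_le[OF assms] by auto
  also have "finite \<dots>" by (intro finite_UN_I finite_family_tree_generation) auto
  finally show ?thesis .
qed

lemma countable_lattice: "countable (UNIV :: (int ^ 'd::finite) set)"
proof (rule countableI')
  \<comment> \<open>A vector is coded by the list of its coordinates along an arbitrary list of all
    indices.\<close>
  show "inj (\<lambda>x::int ^ 'd. to_nat (map (\<lambda>k. x $ k) (SOME ks. set ks = UNIV)))"
  proof (rule injI)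
    fix x y :: "int ^ 'd"
    have *: "set (SOME ks. set ks = (UNIV :: 'd set)) = UNIV"
      by (rule someI_ex) (simp add: finite_list)
    assume "to_nat (map (\<lambda>k. x $ k) (SOME ks. set ks = UNIV)) =
      to_nat (map (\<lambda>k. y $ k) (SOME ks. set ks = UNIV))"
    then show "x = y" using * by (auto simp: vec_eq_iff)
  qed
qed

text \<open>A realisation is a finite set of words with a map from it to the countable lattice.
  Countability allows events to be decomposed along their truncations.\<close>

lemma countable_realisations: "countable (realisations m :: ('d::finite) etree set)"
proof -
  have "countable (\<Union>T\<in>{T :: word set. finite T}. {T} \<times> (T \<rightarrow>\<^sub>E (UNIV :: (int ^ 'd) set)))"
  proof (intro countable_UN countable_SIGMA)
    show "countable {T :: word set. finite T}" by (rule countable_Collect_finite)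
    from countable_lattice show "countable (T \<rightarrow>\<^sub>E (UNIV :: (int ^ 'd) set))" if "T \<in> {T. finite T}" for T :: "word set"
      using that by (intro countable_PiE) auto
  qed auto
  moreover have "C \<in> (\<Union>T\<in>{T :: word set. finite T}. {T} \<times> (T \<rightarrow>\<^sub>E (UNIV :: (int ^ 'd) set)))"
    if "C \<in> realisations m" for C :: "'d etree"
  proof -
    have "snd C \<in> extensional (fst C)"
      using that by (auto simp: realisations_iff elim: embedded_treesE)
    with finite_realisation[OF that] show ?thesis
      by (cases C) (simp add: PiE_def)
  qed
  ultimately show ?thesis
    by (blast intro: countable_subset)
qed

lemma embedded_trees_eqI:
  assumes "s \<in> embedded_trees" "t \<in> embedded_trees" "fst s = fst t"
    and "\<And>i. i \<in> fst s \<Longrightarrow> snd s i = snd t i"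
  shows "s = t"
proof (rule prod_eqI)
  have "snd s \<in> extensional (fst s)" "snd t \<in> extensional (fst s)"
    using assms(1-3) by (auto elim!: embedded_treesE)
  then show "snd s = snd t"
    using assms(4) by (rule extensionalityI)
qed fact

text \<open>Generation zero consists of the root, which sits at the origin. So there is a single
  realisation of depth zero, and its cylinder is the whole space.\<close>

lemma truncate_0_eq:
  assumes "s \<in> embedded_trees" "t \<in> embedded_trees"
  shows "truncate 0 s = truncate 0 t"
proof (rule embedded_trees_eqI)
  obtain \<xi> where s: "fst s = family_tree \<xi>" "snd s root_word = 0"
    by (rule embedded_treesE[OF assms(1)])
  obtain \<xi>' where t: "fst t = family_tree \<xi>'" "snd t root_word = 0"
    by (rule embedded_treesE[OF assms(2)])
  show "fst (truncate 0 s) = fst (truncate 0 t)"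
    by (simp add: fst_truncate s t generation_0_iff)
  fix i assume "i \<in> fst (truncate 0 s)"
  then show "snd (truncate 0 s) i = snd (truncate 0 t) i"
    by (simp add: fst_truncate snd_truncate s t generation_0_iff)
qed (use assms in auto)

section \<open>The branching property\<close>

lemma position_root [simp]: "position \<Delta> root_word = 0"
  by (simp add: position_def root_word_def)

lemma position_snoc: "i \<noteq> [] \<Longrightarrow> position \<Delta> (i @ [k]) = position \<Delta> i + \<Delta> (i @ [k])"
proof -
  assume "i \<noteq> []"
  then have "\<not> length i < 1" by (cases i) auto
  then show ?thesis by (simp add: position_def sum.cl_ivl_Suc)
qed

lemma fst_embed_tree: "fst (embed_tree \<omega>) = family_tree (\<lambda>i. fst (\<omega> i))"
  by (simp add: embed_tree_def Let_def)

lemma snd_embed_tree: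
  "i \<in> family_tree (\<lambda>i. fst (\<omega> i)) \<Longrightarrow> snd (embed_tree \<omega>) i = position (\<lambda>i. snd (\<omega> i)) i"
  by (simp add: embed_tree_def Let_def)

lemma embed_tree_in_embedded_trees [simp]: "embed_tree \<omega> \<in> embedded_trees"
  by (auto simp: embed_tree_def Let_def embedded_trees_def family_tree.root)

text \<open>A cylinder is a finite list of conditions, each on the data of one word. Every non-root
  individual has its displacement prescribed, but offspring numbers are prescribed only below
  generation \<open>m\<close>; those of generation \<open>m\<close> remain free, which is the source
  of the branching property.\<close>

lemma truncate_embed_tree_eq_iff:
  assumes C: "C \<in> realisations m"
  shows "truncate m (embed_tree \<omega>) = C \<longleftrightarrow>
    (\<forall>i\<in>fst C. (generation i < m \<longrightarrow> fst (\<omega> i) = card {k. i @ [k] \<in> fst C}) \<and>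
       (i \<noteq> root_word \<longrightarrow> snd (\<omega> i) = snd C i - snd C (butlast i)))"
    (is "_ \<longleftrightarrow> ?R")
proof
  let ?T = "family_tree (\<lambda>i. fst (\<omega> i))"
  assume trunc: "truncate m (embed_tree \<omega>) = C"
  then have T: "fst C = {i \<in> ?T. generation i \<le> m}"
    by (metis fst_truncate fst_embed_tree)
  have pos: "snd C i = position (\<lambda>i. snd (\<omega> i)) i" if "i \<in> fst C" for i
    using that trunc by (auto simp: T snd_truncate snd_embed_tree fst_embed_tree)
  show ?R
  proof (intro ballI conjI impI)
    fix i assume i: "i \<in> fst C"
    show "fst (\<omega> i) = card {k. i @ [k] \<in> fst C}" if "generation i < m"
    proof -
      have "{k. i @ [k] \<in> fst C} = {1..fst (\<omega> i)}"
        using i that family_tree_children[of i "\<lambda>i. fst (\<omega> i)"] length_family_tree[of i]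
        by (auto simp: T)
      then show ?thesis by simp
    qed
    show "snd (\<omega> i) = snd C i - snd C (butlast i)" if "i \<noteq> root_word"
    proof -
      obtain j k where jk: "i = j @ [k]"
        using i by (cases i rule: rev_cases) (auto simp: T)
      with i that have "j \<in> fst C"
        using length_family_tree[of j] by (auto simp: T snoc_mem_family_tree_iff root_word_def)
      moreover from this have "j \<noteq> []" by (auto simp: T)
      ultimately show ?thesis
        using i jk pos[of i] pos[of j] by (simp add: position_snoc)
    qed
  qed
next
  let ?T = "family_tree (\<lambda>i. fst (\<omega> i))"
  assume R: ?R
  have Ce: "C \<in> embedded_trees" using C by (simp add: realisations_iff)
  then obtain \<xi> where \<xi>: "fst C = family_tree \<xi>" "snd C root_word = 0"
    by (rule embedded_treesE)
  have off: "fst (\<omega> i) = \<xi> i" if "i \<in> fst C" "generation i < m" for i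
    using R that family_tree_children[of i \<xi>] by (auto simp: \<xi>)
  have gen: "generation i \<le> m" if "i \<in> fst C" for i
    by (rule realisations_generation_le[OF C that])
  \<comment> \<open>A word extending an individual of \<open>C\<close> of generation below
    \<open>m\<close> is governed by equal offspring numbers on both sides; any other word can lie in
    either side only if it is the root.\<close>
  have T: "i \<in> ?T \<and> generation i \<le> m \<longleftrightarrow> i \<in> fst C" for i
  proof (induction i rule: rev_induct)
    case (snoc k i)
    show ?case
    proof (cases "i \<in> fst C \<and> generation i < m")
      case True
      with snoc off[of i] length_family_tree[of i \<xi>] show ?thesis
        by (auto simp: \<xi> snoc_mem_family_tree_iff)
    next
      case False
      then have "i @ [k] \<in> fst C \<longleftrightarrow> i = [] \<and> k = 0"
        using gen[of "i @ [k]"] length_family_tree[of i \<xi>] by (auto simp: \<xi> snoc_mem_family_tree_iff)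
      moreover have "i @ [k] \<in> ?T \<and> generation (i @ [k]) \<le> m \<longleftrightarrow> i = [] \<and> k = 0"
        using False snoc length_family_tree[of i "\<lambda>i. fst (\<omega> i)"]
        by (auto simp: snoc_mem_family_tree_iff)
      ultimately show ?thesis by simp
    qed
  qed (auto simp: \<xi>)
  have pos: "position (\<lambda>i. snd (\<omega> i)) i = snd C i" if "i \<in> fst C" for i
    using that
  proof (induction i rule: rev_induct)
    case (snoc k i)
    show ?case
    proof (cases "i = []")
      case True
      with snoc.prems \<xi> have "i @ [k] = root_word"
        using snoc_mem_family_tree_iff[of i k \<xi>] by (auto simp: root_word_def)
      with \<xi> show ?thesis by simp
    next
      case False
      then have "i @ [k] \<noteq> root_word" by (simp add: root_word_def)
      then have "snd (\<omega> (i @ [k])) = snd C (i @ [k]) - snd C i"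
        using R snoc.prems by auto
      moreover have "i \<in> fst C" using snoc.prems False by (auto simp: \<xi> snoc_mem_family_tree_iff)
      ultimately show ?thesis using snoc.IH False by (simp add: position_snoc)
    qed
  qed (auto simp: \<xi>)
  show "truncate m (embed_tree \<omega>) = C"
  proof (rule embedded_trees_eqI)
    show "fst (truncate m (embed_tree \<omega>)) = fst C"
      using T by (auto simp: fst_truncate fst_embed_tree)
    fix i assume "i \<in> fst (truncate m (embed_tree \<omega>))"
    then show "snd (truncate m (embed_tree \<omega>)) i = snd C i"
      using T[of i] pos[of i] by (simp add: fst_truncate snd_truncate fst_embed_tree snd_embed_tree)
  qed (use Ce in auto)
qed

section \<open>Independence of the data attached to words\<close>

definition word_space :: "nat pmf \<Rightarrow> (int ^ 'd) pmf \<Rightarrow> (word \<Rightarrow> nat \<times> (int ^ 'd::finite)) measure" where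
  "word_space p D = Pi\<^sub>M UNIV (\<lambda>_. measure_pmf (pair_pmf p D))"

lemma space_word_space [simp]: "space (word_space p D) = UNIV"
  by (simp add: word_space_def space_PiM)

interpretation word_space: prob_space "word_space p D" for p :: "nat pmf" and D :: "(int ^ 'd::finite) pmf"
  unfolding word_space_def by (intro prob_space_PiM measure_pmf.prob_space_axioms)

lemma measurable_word_space_component [measurable]:
  "(\<lambda>\<omega>. f (\<omega> i)) \<in> borel_measurable (word_space p D)" for f :: "_ \<Rightarrow> ennreal"
proof -
  have "(\<lambda>\<omega>. \<omega> i) \<in> measurable (word_space p D) (measure_pmf (pair_pmf p D))"
    unfolding word_space_def by (rule measurable_component_singleton) simp
  then show ?thesis
    by (rule measurable_compose) simp
qed

text \<open>Independence of finitely many words. The formula holds on the finite product over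
  \<open>J\<close>, which is the image of the infinite product under restriction.\<close>

lemma nn_integral_word_space_prod:
  fixes g :: "word \<Rightarrow> _ \<Rightarrow> ennreal"
  assumes "finite J"
  shows "(\<integral>\<^sup>+\<omega>. (\<Prod>i\<in>J. g i (\<omega> i)) \<partial>word_space p D) = (\<Prod>i\<in>J. \<integral>\<^sup>+x. g i x \<partial>pair_pmf p D)"
proof -
  let ?M = "\<lambda>_::word. measure_pmf (pair_pmf p D)"
  interpret product_prob_space ?M UNIV by standard
  have "(\<Prod>i\<in>J. \<integral>\<^sup>+x. g i x \<partial>pair_pmf p D) = (\<integral>\<^sup>+\<omega>. (\<Prod>i\<in>J. g i (\<omega> i)) \<partial>PiM J ?M)"
    using assms by (intro product_nn_integral_prod[symmetric]) auto
  also have "PiM J ?M = distr (PiM UNIV ?M) (PiM J ?M) (\<lambda>x. restrict x J)"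
    using assms by (simp add: distr_PiM_restrict_finite)
  also have "(\<integral>\<^sup>+\<omega>. (\<Prod>i\<in>J. g i (\<omega> i)) \<partial>\<dots>) = (\<integral>\<^sup>+\<omega>. (\<Prod>i\<in>J. g i (restrict \<omega> J i)) \<partial>PiM UNIV ?M)"
  proof (rule nn_integral_distr)
    have "(\<lambda>\<omega>. g i (\<omega> i)) \<in> borel_measurable (PiM J ?M)" if "i \<in> J" for i
      by (rule measurable_compose[OF measurable_component_singleton[OF that]]) simp
    then show "(\<lambda>\<omega>. \<Prod>i\<in>J. g i (\<omega> i)) \<in>
        borel_measurable (distr (PiM UNIV ?M) (PiM J ?M) (\<lambda>x. restrict x J))"
      by (simp add: borel_measurable_prod_ennreal)
  qed (rule measurable_restrict_subset, simp)
  also have "\<dots> = (\<integral>\<^sup>+\<omega>. (\<Prod>i\<in>J. g i (\<omega> i)) \<partial>word_space p D)"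
    unfolding word_space_def by (intro nn_integral_cong prod.cong) auto
  finally show ?thesis by simp
qed

text \<open>The factor that word \<open>i\<close> contributes to the indicator of a cylinder; the
  value one stands for the absence of a condition.\<close>

definition cyl_weight :: "nat \<Rightarrow> ('d::finite) etree \<Rightarrow> word \<Rightarrow> nat \<times> (int ^ 'd) \<Rightarrow> ennreal" where
  "cyl_weight m C i x =
     (if generation i < m then indicator {card {k. i @ [k] \<in> fst C}} (fst x) else 1) *
     (if i \<noteq> root_word then indicator {snd C i - snd C (butlast i)} (snd x) else 1)"

lemma indicator_truncate_embed_tree:
  assumes C: "C \<in> realisations m"
  shows "indicator {\<omega>. truncate m (embed_tree \<omega>) = C} \<omega> = (\<Prod>i\<in>fst C. cyl_weight m C i (\<omega> i))"
proof (cases "truncate m (embed_tree \<omega>) = C")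
  case True
  with truncate_embed_tree_eq_iff[OF C] have "cyl_weight m C i (\<omega> i) = 1" if "i \<in> fst C" for i
    using that by (auto simp: cyl_weight_def indicator_def)
  with True show ?thesis by simp
next
  case False
  with truncate_embed_tree_eq_iff[OF C] obtain i where "i \<in> fst C" "cyl_weight m C i (\<omega> i) = 0"
    by (auto simp: cyl_weight_def indicator_def)
  with False finite_realisation[OF C] show ?thesis
    by (auto simp: indicator_def intro!: prod_zero[symmetric])
qed

lemma sets_truncate_embed_tree:
  "{\<omega>. truncate m (embed_tree \<omega>) = C} \<in> sets (word_space p D)"
proof (cases "C \<in> realisations m")
  case True
  have "(\<lambda>\<omega>. indicator {\<omega>. truncate m (embed_tree \<omega>) = C} \<omega> :: ennreal) \<in> borel_measurable (word_space p D)"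
    unfolding indicator_truncate_embed_tree[OF True] by measurable
  then show ?thesis by (simp add: borel_measurable_indicator_iff)
next
  case False
  then have "{\<omega>. truncate m (embed_tree \<omega>) = C} = {}"
    by (auto simp: truncate_realisations)
  then show ?thesis by simp
qed

lemma measurable_truncate_embed_tree [measurable]:
  "(\<lambda>\<omega>. truncate m (embed_tree \<omega>)) \<in> measurable (word_space p D) (count_space (realisations m))"
  by (simp add: measurable_count_space_eq_countable countable_realisations vimage_def
      sets_truncate_embed_tree truncate_realisations Pi_iff)

lemma measurable_num_gen [measurable]:
  "(\<lambda>\<omega>. num_gen n (fst (embed_tree \<omega>))) \<in> measurable (word_space p D) (count_space UNIV)"
proof -
  have "(\<lambda>\<omega>. num_gen n (fst (truncate n (embed_tree \<omega>)))) \<in> measurable (word_space p D) (count_space UNIV)"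
    by (rule measurable_compose[OF measurable_truncate_embed_tree]) simp
  then show ?thesis by (simp add: num_gen_truncate)
qed

text \<open>The branching property: the cylinder puts no condition on the offspring numbers of
  generation \<open>n\<close>, so on it they remain independent with law \<open>p\<close>.\<close>

lemma nn_integral_generation_prod:
  fixes h :: "word \<Rightarrow> nat \<Rightarrow> ennreal" and C :: "('d::finite) etree"
  assumes C: "C \<in> realisations n"
  defines "G \<equiv> {i \<in> fst C. generation i = n}"
  shows "(\<integral>\<^sup>+\<omega>. (\<Prod>i\<in>G. h i (fst (\<omega> i))) * indicator {\<omega>. truncate n (embed_tree \<omega>) = C} \<omega> \<partial>word_space p D) =
    (\<Prod>i\<in>G. \<integral>\<^sup>+k. h i k \<partial>p) * emeasure (word_space p D) {\<omega>. truncate n (embed_tree \<omega>) = C}"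
proof -
  \<comment> \<open>Extending \<open>h\<close> by one to the earlier generations lets the product
    run over all of \<open>fst C\<close> and merge with the cylinder weights.\<close>
  define H where "H i = (if generation i = n then h i else (\<lambda>_. 1))" for i
  note fin = finite_realisation[OF C]
  have prod_H: "(\<Prod>i\<in>fst C. F (H i) i) = (\<Prod>i\<in>G. F (h i) i)" if "\<And>i. F (\<lambda>_. 1) i = 1"
    for F :: "(nat \<Rightarrow> ennreal) \<Rightarrow> word \<Rightarrow> ennreal"
    unfolding G_def using fin that
    by (intro prod.mono_neutral_cong_right) (auto simp: H_def)
  \<comment> \<open>In generation \<open>n\<close> the weight involves only the displacement, which
    is independent of the offspring number; elsewhere \<open>H\<close> is constant.\<close>
  have factor: "(\<integral>\<^sup>+x. H i (fst x) * cyl_weight n C i x \<partial>pair_pmf p D) =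
      (\<integral>\<^sup>+k. H i k \<partial>p) * (\<integral>\<^sup>+x. cyl_weight n C i x \<partial>pair_pmf p D)" for i
    by (cases "generation i = n"; cases "i = root_word")
       (simp_all add: H_def cyl_weight_def nn_integral_pair_pmf' nn_integral_cmult nn_integral_multc)
  have "(\<integral>\<^sup>+\<omega>. (\<Prod>i\<in>G. h i (fst (\<omega> i))) * indicator {\<omega>. truncate n (embed_tree \<omega>) = C} \<omega> \<partial>word_space p D)
      = (\<integral>\<^sup>+\<omega>. (\<Prod>i\<in>fst C. H i (fst (\<omega> i)) * cyl_weight n C i (\<omega> i)) \<partial>word_space p D)"
    using prod_H[of "\<lambda>f i. f (fst (\<omega> i))" for \<omega> :: "word \<Rightarrow> nat \<times> (int ^ 'd)"]
    by (simp add: indicator_truncate_embed_tree[OF C] prod.distrib)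
  also have "\<dots> = (\<Prod>i\<in>fst C. \<integral>\<^sup>+k. H i k \<partial>p) * (\<Prod>i\<in>fst C. \<integral>\<^sup>+x. cyl_weight n C i x \<partial>pair_pmf p D)"
    by (subst nn_integral_word_space_prod[OF fin, where g = "\<lambda>i x. H i (fst x) * cyl_weight n C i x"])
       (simp add: factor prod.distrib)
  also have "(\<Prod>i\<in>fst C. \<integral>\<^sup>+k. H i k \<partial>p) = (\<Prod>i\<in>G. \<integral>\<^sup>+k. h i k \<partial>p)"
    by (rule prod_H) simp
  also have "(\<Prod>i\<in>fst C. \<integral>\<^sup>+x. cyl_weight n C i x \<partial>pair_pmf p D) =
      (\<integral>\<^sup>+\<omega>. indicator {\<omega>. truncate n (embed_tree \<omega>) = C} \<omega> \<partial>word_space p D)"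
    by (simp only: indicator_truncate_embed_tree[OF C] nn_integral_word_space_prod[OF fin])
  finally show ?thesis
    by (simp add: sets_truncate_embed_tree)
qed

section \<open>Generating functions and means of generation sizes on cylinders\<close>

lemma num_gen_Suc_embed_tree:
  assumes "truncate n (embed_tree \<omega>) = C"
  shows "num_gen (Suc n) (fst (embed_tree \<omega>)) = (\<Sum>i\<in>{i \<in> fst C. generation i = n}. fst (\<omega> i))"
proof -
  have "{i \<in> fst C. generation i = n} = {i \<in> family_tree (\<lambda>i. fst (\<omega> i)). generation i = n}"
    using assms fst_truncate[of n "embed_tree \<omega>"] by (auto simp: fst_embed_tree)
  then show ?thesis by (simp add: fst_embed_tree num_gen_Suc)
qed

text \<open>The probability generating function, extended-valued so that no integrability is at
  stake.\<close>

definition pgf :: "nat pmf \<Rightarrow> ennreal \<Rightarrow> ennreal" where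
  "pgf p s = (\<integral>\<^sup>+k. s ^ k \<partial>p)"

text \<open>On the cylinder the next generation is a sum of independent offspring numbers, so each
  individual of generation \<open>n\<close> contributes one factor \<open>pgf p s\<close>.\<close>

lemma nn_integral_power_num_gen_Suc:
  assumes C: "C \<in> realisations n"
  shows "(\<integral>\<^sup>+\<omega>. s ^ num_gen (Suc n) (fst (embed_tree \<omega>)) * indicator {\<omega>. truncate n (embed_tree \<omega>) = C} \<omega> \<partial>word_space p D)
    = (\<integral>\<^sup>+\<omega>. pgf p s ^ num_gen n (fst (embed_tree \<omega>)) * indicator {\<omega>. truncate n (embed_tree \<omega>) = C} \<omega> \<partial>word_space p D)"
    (is "?L = ?R")
proof -
  let ?E = "{\<omega>. truncate n (embed_tree \<omega>) = C}"
  let ?G = "{i \<in> fst C. generation i = n}"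
  have "?L = (\<integral>\<^sup>+\<omega>. (\<Prod>i\<in>?G. s ^ fst (\<omega> i)) * indicator ?E \<omega> \<partial>word_space p D)"
    by (intro nn_integral_cong) (simp add: num_gen_Suc_embed_tree power_sum split: split_indicator)
  also have "\<dots> = pgf p s ^ num_gen n (fst C) * emeasure (word_space p D) ?E"
    by (subst nn_integral_generation_prod[OF C, where h = "\<lambda>_ k. s ^ k"]) (simp add: pgf_def num_gen_def)
  also have "\<dots> = (\<integral>\<^sup>+\<omega>. pgf p s ^ num_gen n (fst C) * indicator ?E \<omega> \<partial>word_space p D)"
    by (simp add: nn_integral_cmult_indicator sets_truncate_embed_tree)
  also have "\<dots> = ?R"
    by (intro nn_integral_cong) (auto simp: num_gen_truncate split: split_indicator)
  finally show ?thesis .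
qed

lemma nn_integral_num_gen_Suc:
  fixes p :: "nat pmf"
  assumes C: "C \<in> realisations n" and mean: "(\<integral>\<^sup>+k. of_nat k \<partial>p) = 1"
  shows "(\<integral>\<^sup>+\<omega>. of_nat (num_gen (Suc n) (fst (embed_tree \<omega>))) * indicator {\<omega>. truncate n (embed_tree \<omega>) = C} \<omega> \<partial>word_space p D)
    = (\<integral>\<^sup>+\<omega>. of_nat (num_gen n (fst (embed_tree \<omega>))) * indicator {\<omega>. truncate n (embed_tree \<omega>) = C} \<omega> \<partial>word_space p D)"
    (is "?L = ?R")
proof -
  let ?E = "{\<omega>. truncate n (embed_tree \<omega>) = C}"
  let ?G = "{i \<in> fst C. generation i = n}"
  \<comment> \<open>The product of \<open>?h j\<close> over the generation is the offspring number
    of \<open>j\<close> alone, which writes the sum of offspring numbers as a sum of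
    products.\<close>
  let ?h = "\<lambda>j i k. if i = j then of_nat k else (1 :: ennreal)"
  have fin: "finite ?G" using finite_realisation[OF C] by simp
  have "?L = (\<integral>\<^sup>+\<omega>. (\<Sum>j\<in>?G. (\<Prod>i\<in>?G. ?h j i (fst (\<omega> i))) * indicator ?E \<omega>) \<partial>word_space p D)"
    using fin by (intro nn_integral_cong)
      (auto simp: num_gen_Suc_embed_tree sum_distrib_right of_nat_sum split: split_indicator)
  also have "\<dots> = (\<Sum>j\<in>?G. \<integral>\<^sup>+\<omega>. (\<Prod>i\<in>?G. ?h j i (fst (\<omega> i))) * indicator ?E \<omega> \<partial>word_space p D)"
  proof (rule nn_integral_sum)
    fix j
    have [measurable]: "(\<lambda>\<omega>. ?h j i (fst (\<omega> i))) \<in> borel_measurable (word_space p D)" for i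
      by (rule measurable_word_space_component)
    have [measurable]: "?E \<in> sets (word_space p D)"
      by (rule sets_truncate_embed_tree)
    show "(\<lambda>\<omega>. (\<Prod>i\<in>?G. ?h j i (fst (\<omega> i))) * indicator ?E \<omega>) \<in> borel_measurable (word_space p D)"
      by measurable
  qed
  also have "\<dots> = (\<Sum>j\<in>?G. emeasure (word_space p D) ?E)"
  proof (intro sum.cong refl)
    fix j assume "j \<in> ?G"
    have "(\<integral>\<^sup>+k. ?h j i k \<partial>p) = 1" for i
      by (cases "i = j") (simp_all add: mean)
    then show "(\<integral>\<^sup>+\<omega>. (\<Prod>i\<in>?G. ?h j i (fst (\<omega> i))) * indicator ?E \<omega> \<partial>word_space p D) = emeasure (word_space p D) ?E"
      by (subst nn_integral_generation_prod[OF C]) simp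
  qed
  also have "\<dots> = (\<integral>\<^sup>+\<omega>. of_nat (num_gen n (fst C)) * indicator ?E \<omega> \<partial>word_space p D)"
    by (simp add: nn_integral_cmult_indicator sets_truncate_embed_tree num_gen_def)
  also have "\<dots> = ?R"
    by (intro nn_integral_cong) (auto simp: num_gen_truncate split: split_indicator)
  finally show ?thesis .
qed

text \<open>A cylinder is the countable disjoint union of its refinements at depth \<open>n\<close>;
  the claim is countable additivity of the measure with density \<open>f\<close>. Identities valid
  on deep cylinders thereby pass to shallow ones.\<close>

lemma nn_integral_cylinder_sum:
  assumes "m \<le> n" and [measurable]: "f \<in> borel_measurable (word_space p D)"
  shows "(\<integral>\<^sup>+\<omega>. f \<omega> * indicator {\<omega>. truncate m (embed_tree \<omega>) = C} \<omega> \<partial>word_space p D) =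
      (\<integral>\<^sup>+C'. (\<integral>\<^sup>+\<omega>. f \<omega> * indicator {\<omega>. truncate n (embed_tree \<omega>) = C'} \<omega> \<partial>word_space p D)
        \<partial>count_space {C' \<in> realisations n. truncate m C' = C})"
proof -
  let ?E = "\<lambda>C. {\<omega>. truncate n (embed_tree \<omega>) = C}"
  let ?I = "{C' \<in> realisations n. truncate m C' = C}"
  have E: "{\<omega>. truncate m (embed_tree \<omega>) = C} = (\<Union>C'\<in>?I. ?E C')"
  proof (rule set_eqI)
    fix \<omega>
    have "\<omega> \<in> (\<Union>C'\<in>?I. ?E C') \<longleftrightarrow> truncate n (embed_tree \<omega>) \<in> ?I" by blast
    then show "\<omega> \<in> {\<omega>. truncate m (embed_tree \<omega>) = C} \<longleftrightarrow> \<omega> \<in> (\<Union>C'\<in>?I. ?E C')"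
      using \<open>m \<le> n\<close> by (simp add: truncate_realisations min_absorb1)
  qed
  have "countable ?I"
    using countable_realisations[of n] by (rule countable_subset[rotated]) auto
  then have "emeasure (density (word_space p D) f) (\<Union>C'\<in>?I. ?E C') =
      (\<integral>\<^sup>+C'. emeasure (density (word_space p D) f) (?E C') \<partial>count_space ?I)"
    by (intro emeasure_UN_countable)
       (auto simp: sets_truncate_embed_tree disjoint_family_on_def)
  then show ?thesis
    by (simp add: E[symmetric] emeasure_density sets_truncate_embed_tree)
qed

lemma nn_integral_cylinder_refine:
  assumes "m \<le> n"
    and "g \<in> borel_measurable (word_space p D)" "h \<in> borel_measurable (word_space p D)"
    and eq: "\<And>C. C \<in> realisations n \<Longrightarrow>
      (\<integral>\<^sup>+\<omega>. g \<omega> * indicator {\<omega>. truncate n (embed_tree \<omega>) = C} \<omega> \<partial>word_space p D) =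
      (\<integral>\<^sup>+\<omega>. h \<omega> * indicator {\<omega>. truncate n (embed_tree \<omega>) = C} \<omega> \<partial>word_space p D)"
  shows "(\<integral>\<^sup>+\<omega>. g \<omega> * indicator {\<omega>. truncate m (embed_tree \<omega>) = C} \<omega> \<partial>word_space p D) =
      (\<integral>\<^sup>+\<omega>. h \<omega> * indicator {\<omega>. truncate m (embed_tree \<omega>) = C} \<omega> \<partial>word_space p D)"
  unfolding nn_integral_cylinder_sum[OF assms(1,2)] nn_integral_cylinder_sum[OF assms(1,3)]
  by (rule nn_integral_cong) (simp add: eq)

text \<open>The one-step identity acts on the last generation and replaces \<open>s\<close> by
  \<open>pgf p s\<close>, so the induction must keep \<open>s\<close> arbitrary.\<close>

lemma nn_integral_power_num_gen:
  "(\<integral>\<^sup>+\<omega>. s ^ num_gen (m + j) (fst (embed_tree \<omega>)) * indicator {\<omega>. truncate m (embed_tree \<omega>) = C} \<omega> \<partial>word_space p D)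
    = (pgf p ^^ j) s ^ num_gen m (fst C) * emeasure (word_space p D) {\<omega>. truncate m (embed_tree \<omega>) = C}"
proof (induction j arbitrary: s)
  case 0
  have "(\<integral>\<^sup>+\<omega>. s ^ num_gen m (fst (embed_tree \<omega>)) * indicator {\<omega>. truncate m (embed_tree \<omega>) = C} \<omega> \<partial>word_space p D)
     = (\<integral>\<^sup>+\<omega>. s ^ num_gen m (fst C) * indicator {\<omega>. truncate m (embed_tree \<omega>) = C} \<omega> \<partial>word_space p D)"
    by (intro nn_integral_cong) (auto simp: num_gen_truncate split: split_indicator)
  then show ?case by (simp add: nn_integral_cmult_indicator sets_truncate_embed_tree)
next
  case (Suc j)
  have "(\<integral>\<^sup>+\<omega>. s ^ num_gen (m + Suc j) (fst (embed_tree \<omega>)) * indicator {\<omega>. truncate m (embed_tree \<omega>) = C} \<omega> \<partial>word_space p D)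
    = (\<integral>\<^sup>+\<omega>. pgf p s ^ num_gen (m + j) (fst (embed_tree \<omega>)) * indicator {\<omega>. truncate m (embed_tree \<omega>) = C} \<omega> \<partial>word_space p D)"
    by (rule nn_integral_cylinder_refine[of m "m + j"])
       (simp_all add: nn_integral_power_num_gen_Suc)
  then show ?case by (simp add: Suc funpow_swap1)
qed

text \<open>The martingale property of the generation sizes, tested on cylinders: mean one makes
  each step preserve the integral.\<close>

lemma nn_integral_num_gen:
  fixes p :: "nat pmf"
  assumes "(\<integral>\<^sup>+k. of_nat k \<partial>p) = 1"
  shows "(\<integral>\<^sup>+\<omega>. of_nat (num_gen (m + j) (fst (embed_tree \<omega>))) * indicator {\<omega>. truncate m (embed_tree \<omega>) = C} \<omega> \<partial>word_space p D)
    = of_nat (num_gen m (fst C)) * emeasure (word_space p D) {\<omega>. truncate m (embed_tree \<omega>) = C}"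
proof (induction j)
  case 0
  have "(\<integral>\<^sup>+\<omega>. of_nat (num_gen m (fst (embed_tree \<omega>))) * indicator {\<omega>. truncate m (embed_tree \<omega>) = C} \<omega> \<partial>word_space p D)
     = (\<integral>\<^sup>+\<omega>. of_nat (num_gen m (fst C)) * indicator {\<omega>. truncate m (embed_tree \<omega>) = C} \<omega> \<partial>word_space p D)"
    by (intro nn_integral_cong) (auto simp: num_gen_truncate split: split_indicator)
  then show ?case by (simp add: nn_integral_cmult_indicator sets_truncate_embed_tree)
next
  case (Suc j)
  have "(\<integral>\<^sup>+\<omega>. of_nat (num_gen (m + Suc j) (fst (embed_tree \<omega>))) * indicator {\<omega>. truncate m (embed_tree \<omega>) = C} \<omega> \<partial>word_space p D)
    = (\<integral>\<^sup>+\<omega>. of_nat (num_gen (m + j) (fst (embed_tree \<omega>))) * indicator {\<omega>. truncate m (embed_tree \<omega>) = C} \<omega> \<partial>word_space p D)"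
    by (rule nn_integral_cylinder_refine[of m "m + j"])
       (simp_all add: nn_integral_num_gen_Suc[OF _ assms])
  then show ?case by (simp add: Suc)
qed

section \<open>The measures of cylinders at finite times\<close>

lemma cylinders_subset: "{cylinder m C | m C. C \<in> realisations m} \<subseteq> Pow embedded_trees"
  by (auto simp: cylinder_def)

lemma space_etree_space [simp]: "space etree_space = embedded_trees"
  unfolding etree_space_def by (rule space_measure_of[OF cylinders_subset])

lemma sets_etree_space: "sets etree_space = sigma_sets embedded_trees {cylinder m C | m C. C \<in> realisations m}"
  unfolding etree_space_def by (rule sets_measure_of[OF cylinders_subset])

lemma cylinder_in_sets: "C \<in> realisations m \<Longrightarrow> cylinder m C \<in> sets etree_space"
  unfolding sets_etree_space by (rule sigma_sets.Basic) blast

text \<open>An event decided by a truncation is a countable union of cylinders.\<close>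

lemma sets_etree_space_truncate: "{t \<in> embedded_trees. P (truncate m t)} \<in> sets etree_space"
proof -
  have "{t \<in> embedded_trees. P (truncate m t)} = (\<Union>C\<in>{C \<in> realisations m. P C}. cylinder m C)"
    by (auto simp: cylinder_def truncate_realisations)
  also have "\<dots> \<in> sets etree_space"
    by (rule sets.countable_UN')
       (auto intro: countable_subset[OF _ countable_realisations] cylinder_in_sets)
  finally show ?thesis .
qed

lemma measurable_etree_spaceI:
  fixes f :: "'w \<Rightarrow> ('d::finite) etree"
  assumes "\<And>\<omega>. \<omega> \<in> space M \<Longrightarrow> f \<omega> \<in> embedded_trees"
    and "\<And>m C. C \<in> realisations m \<Longrightarrow> {\<omega> \<in> space M. truncate m (f \<omega>) = C} \<in> sets M"
  shows "f \<in> measurable M etree_space"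
  unfolding etree_space_def
proof (rule measurable_measure_of[OF cylinders_subset])
  fix Y :: "'d etree set" assume "Y \<in> {cylinder m C |m C. C \<in> realisations m}"
  then obtain m C where "Y = cylinder m C" "C \<in> realisations m" by auto
  moreover from this have "f -` Y \<inter> space M = {\<omega> \<in> space M. truncate m (f \<omega>) = C}"
    using assms(1) by (auto simp: cylinder_def)
  ultimately show "f -` Y \<inter> space M \<in> sets M"
    using assms(2) by simp
qed (use assms(1) in auto)

lemma measurable_embed_tree: "embed_tree \<in> measurable (word_space p D) etree_space"
  by (rule measurable_etree_spaceI) (auto simp: sets_truncate_embed_tree)

text \<open>The auxiliary predicate \<open>P'\<close> certifies that the event is decided at finite
  depth and hence is measurable; its probability can then be computed on
  \<open>word_space\<close>.\<close>

lemma measure_brw_Collect: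
  assumes "\<And>t. t \<in> embedded_trees \<Longrightarrow> P t \<longleftrightarrow> P' (truncate n t)"
  shows "\<P>(t in brw p D. P t) = measure (word_space p D) {\<omega>. P (embed_tree \<omega>)}"
proof -
  have "\<P>(t in brw p D. P t) = measure (distr (word_space p D) etree_space embed_tree) {t \<in> embedded_trees. P t}"
    by (simp add: brw_def word_space_def)
  also have "\<dots> = measure (word_space p D) {\<omega>. P (embed_tree \<omega>)}"
  proof (subst measure_distr[OF measurable_embed_tree])
    have "{t \<in> embedded_trees. P t} = {t \<in> embedded_trees. P' (truncate n t)}"
      using assms by auto
    then show "{t \<in> embedded_trees. P t} \<in> sets etree_space"
      by (simp add: sets_etree_space_truncate)
  qed (simp add: vimage_def)
  finally show ?thesis .
qed

definition cyl_prob :: "nat pmf \<Rightarrow> (int ^ 'd) pmf \<Rightarrow> nat \<Rightarrow> ('d::finite) etree \<Rightarrow> real" where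
  "cyl_prob p D m C = measure (word_space p D) {\<omega>. truncate m (embed_tree \<omega>) = C}"

lemma emeasure_cyl_prob:
  "emeasure (word_space p D) {\<omega>. truncate m (embed_tree \<omega>) = C} = ennreal (cyl_prob p D m C)"
  by (simp add: cyl_prob_def word_space.emeasure_eq_measure)

text \<open>The bridge from the unordered real sums in \<open>P_n\<close> to extended integrals,
  where sums may be interchanged freely; the finite value \<open>c\<close> supplies
  summability.\<close>

lemma infsum_eq_nn_integral:
  fixes f :: "'a \<Rightarrow> real"
  assumes "\<And>x. 0 \<le> f x" and "(\<integral>\<^sup>+x. ennreal (f x) \<partial>count_space A) = ennreal c" and "0 \<le> c"
  shows "infsum f A = c"
proof -
  have "Infinite_Set_Sum.abs_summable_on f A"
    unfolding Infinite_Set_Sum.abs_summable_on_def using assms by (intro integrableI_bounded) auto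
  then have "infsum f A = infsetsum f A"
    by (simp add: infsetsum_infsum)
  also have "\<dots> = c"
    using assms by (simp add: infsetsum_conv_nn_integral)
  finally show ?thesis .
qed

lemma num_gen_embedded_eq_0_iff:
  "t \<in> embedded_trees \<Longrightarrow> num_gen n (fst t) = 0 \<longleftrightarrow> \<not> (\<exists>i\<in>fst t. generation i = n)"
  by (auto simp: num_gen_def card_eq_0_iff finite_family_tree_generation elim!: embedded_treesE)

text \<open>Summing over \<open>x\<close> forgets the position of \<open>i\<close>, and summing over
  \<open>i\<close> counts generation \<open>n\<close>. After interchanging sums and expectation the
  martingale property gives the value.\<close>

lemma P_n_eq:
  fixes p :: "nat pmf" and D :: "(int ^ 'd::finite) pmf"
  assumes "m \<le> n" and mean: "(\<integral>\<^sup>+k. of_nat k \<partial>p) = 1"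
  shows "P_n p D n m C = real (num_gen m (fst C)) * cyl_prob p D m C"
proof -
  let ?W = "word_space p D"
  define E where "E i x = {\<omega> :: word \<Rightarrow> nat \<times> (int ^ 'd). truncate m (embed_tree \<omega>) = C \<and> i \<in> fst (embed_tree \<omega>) \<and>
    snd (embed_tree \<omega>) i = x}" for i x
  define E' where "E' i = {\<omega> :: word \<Rightarrow> nat \<times> (int ^ 'd). truncate m (embed_tree \<omega>) = C \<and> i \<in> fst (embed_tree \<omega>)}" for i
  let ?c = "real (num_gen m (fst C)) * cyl_prob p D m C"
  \<comment> \<open>Depth \<open>max m (generation i)\<close> is enough to decide both the cylinder
    and the position of \<open>i\<close>.\<close>
  have summand: "\<P>(t in brw p D. truncate m t = C \<and> i \<in> fst t \<and> snd t i = x) = measure ?W (E i x)" for i x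
    unfolding E_def
    by (rule measure_brw_Collect[where n = "max m (generation i)" and
          P' = "\<lambda>t. truncate m t = C \<and> i \<in> fst t \<and> snd t i = x"])
       (auto simp: fst_truncate snd_truncate min_absorb1)
  have meas: "{\<omega>. P (truncate k (embed_tree \<omega>))} \<in> sets ?W" for k P
    using measurable_sets[OF measurable_embed_tree sets_etree_space_truncate[of P k], of p D]
    by (simp add: vimage_def)
  have E_sets: "E i x \<in> sets ?W" for i x
    using meas[of "\<lambda>t. truncate m t = C \<and> i \<in> fst t \<and> snd t i = x" "max m (generation i)"]
    by (simp add: E_def fst_truncate snd_truncate min_absorb1 conj_ac cong: conj_cong)
  have E'_sets [measurable]: "E' i \<in> sets ?W" for i
    using meas[of "\<lambda>t. truncate m t = C \<and> i \<in> fst t" "max m (generation i)"]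
    by (simp add: E'_def fst_truncate min_absorb1)
  have [simp]: "countable (UNIV :: (int ^ 'd) set)" by (rule countable_lattice)
  have sum_E: "(\<integral>\<^sup>+x. emeasure ?W (E i x) \<partial>count_space UNIV) = emeasure ?W (E' i)" for i
  proof -
    have "E' i = (\<Union>x. E i x)" by (auto simp: E_def E'_def)
    then show ?thesis
      using E_sets by (simp only:) (subst emeasure_UN_countable, auto simp: disjoint_family_on_def E_def)
  qed
  have "(\<integral>\<^sup>+x. \<integral>\<^sup>+i. emeasure ?W (E i x) \<partial>count_space {i. generation i = n} \<partial>count_space UNIV) =
      (\<integral>\<^sup>+i. \<integral>\<^sup>+x. emeasure ?W (E i x) \<partial>count_space UNIV \<partial>count_space {i. generation i = n})"
    by (rule nn_integral_count_space_nn_integral) auto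
  also have "\<dots> = (\<integral>\<^sup>+i. \<integral>\<^sup>+\<omega>. indicator (E' i) \<omega> \<partial>?W \<partial>count_space {i. generation i = n})"
    by (simp add: sum_E)
  also have "\<dots> = (\<integral>\<^sup>+\<omega>. \<integral>\<^sup>+i. indicator (E' i) \<omega> \<partial>count_space {i. generation i = n} \<partial>?W)"
    by (rule nn_integral_count_space_nn_integral[symmetric]) auto
  also have "\<dots> = (\<integral>\<^sup>+\<omega>. of_nat (num_gen n (fst (embed_tree \<omega>))) *
      indicator {\<omega>. truncate m (embed_tree \<omega>) = C} \<omega> \<partial>?W)"
  proof (rule nn_integral_cong)
    fix \<omega> :: "word \<Rightarrow> nat \<times> (int ^ 'd)"
    let ?G = "{i \<in> fst (embed_tree \<omega>). generation i = n}"
    have "(\<integral>\<^sup>+i. indicator (E' i) \<omega> \<partial>count_space {i. generation i = n}) =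
       (\<integral>\<^sup>+i. indicator {\<omega>. truncate m (embed_tree \<omega>) = C} \<omega> * indicator ?G i \<partial>count_space {i. generation i = n})"
      by (intro nn_integral_cong) (auto simp: E'_def indicator_def)
    also have "\<dots> = indicator {\<omega>. truncate m (embed_tree \<omega>) = C} \<omega> * emeasure (count_space {i. generation i = n}) ?G"
      by (rule nn_integral_cmult_indicator) auto
    also have "emeasure (count_space {i. generation i = n}) ?G = of_nat (num_gen n (fst (embed_tree \<omega>)))"
      by (subst emeasure_count_space_finite)
         (auto simp: num_gen_def fst_embed_tree finite_family_tree_generation)
    finally show "(\<integral>\<^sup>+i. indicator (E' i) \<omega> \<partial>count_space {i. generation i = n}) =
       of_nat (num_gen n (fst (embed_tree \<omega>))) * indicator {\<omega>. truncate m (embed_tree \<omega>) = C} \<omega>"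
      by (simp add: mult.commute)
  qed
  also have "\<dots> = of_nat (num_gen m (fst C)) * emeasure ?W {\<omega>. truncate m (embed_tree \<omega>) = C}"
    using nn_integral_num_gen[OF mean, where m = m and j = "n - m" and C = C and D = D] \<open>m \<le> n\<close> by simp
  also have "\<dots> = ennreal ?c"
    by (simp add: emeasure_cyl_prob ennreal_mult' ennreal_of_nat_eq_real_of_nat)
  finally have total: "(\<integral>\<^sup>+x. \<integral>\<^sup>+i. emeasure ?W (E i x) \<partial>count_space {i. generation i = n} \<partial>count_space UNIV) = ennreal ?c" .
  define S where "S x = (\<integral>\<^sup>+i. emeasure ?W (E i x) \<partial>count_space {i. generation i = n})" for x
  \<comment> \<open>Each inner sum is one term of the finite total, so it may be read as a real
    sum.\<close>
  have S_fin: "S x < \<infinity>" for x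
  proof -
    have "S x = (\<integral>\<^sup>+y. S y * indicator {x} y \<partial>count_space UNIV)"
      by (simp add: nn_integral_count_space_indicator[symmetric] nn_integral_count_space_finite)
    also have "\<dots> \<le> (\<integral>\<^sup>+y. S y \<partial>count_space UNIV)"
      by (intro nn_integral_mono) (auto split: split_indicator)
    also have "\<dots> < \<infinity>" by (simp add: S_def total)
    finally show ?thesis .
  qed
  have inner: "(\<Sum>\<^sub>\<infinity>i\<in>{i. generation i = n}. measure ?W (E i x)) = enn2real (S x)" for x
    using S_fin[of x]
    by (intro infsum_eq_nn_integral) (auto simp: S_def word_space.emeasure_eq_measure)
  have "P_n p D n m C = (\<Sum>\<^sub>\<infinity>x. enn2real (S x))"
    by (simp only: P_n_def summand inner)
  also have "\<dots> = ?c"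
    using S_fin total by (intro infsum_eq_nn_integral) (auto simp: S_def cyl_prob_def)
  finally show ?thesis .
qed

text \<open>The probability that generation \<open>n\<close> is empty, obtained as the iterated
  generating function at zero; \<open>measure_survive\<close> confirms this reading.\<close>

definition extinct :: "nat pmf \<Rightarrow> nat \<Rightarrow> real" where
  "extinct p n = enn2real ((pgf p ^^ n) 0)"

lemma pgf_le_1: "s \<le> 1 \<Longrightarrow> pgf p s \<le> 1"
proof -
  assume "s \<le> 1"
  then have "pgf p s \<le> (\<integral>\<^sup>+k. 1 \<partial>p)"
    unfolding pgf_def by (intro nn_integral_mono power_le_one) auto
  then show ?thesis by simp
qed

lemma pgf_funpow_0_le_1: "(pgf p ^^ n) 0 \<le> 1"
  by (induction n) (auto intro: pgf_le_1)

lemma ennreal_extinct: "ennreal (extinct p n) = (pgf p ^^ n) 0"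
  unfolding extinct_def by (rule ennreal_enn2real) (metis ennreal_one_less_top le_less_trans pgf_funpow_0_le_1)

lemma extinct_nonneg: "0 \<le> extinct p n"
  by (simp add: extinct_def)

lemma extinct_le_1: "extinct p n \<le> 1"
  using pgf_funpow_0_le_1[where n=n and p=p] by (simp flip: ennreal_extinct)

lemma extinct_0 [simp]: "extinct p 0 = 0"
  by (simp add: extinct_def)

lemma extinct_Suc: "extinct p (Suc n) = (\<integral>k. extinct p n ^ k \<partial>p)"
proof -
  have "extinct p (Suc n) = enn2real (\<integral>\<^sup>+k. ennreal (extinct p n ^ k) \<partial>p)"
    by (simp add: extinct_def[of p "Suc n"] pgf_def ennreal_extinct flip: ennreal_power[OF extinct_nonneg])
  also have "\<dots> = (\<integral>k. extinct p n ^ k \<partial>p)"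
    by (rule integral_eq_nn_integral[symmetric]) (auto simp: extinct_nonneg)
  finally show ?thesis .
qed

lemma sets_num_gen: "{\<omega>. truncate m (embed_tree \<omega>) = C \<and> P (num_gen n (fst (embed_tree \<omega>)))} \<in> sets (word_space p D)"
proof -
  have "{\<omega> \<in> space (word_space p D). P (num_gen n (fst (embed_tree \<omega>)))} \<in> sets (word_space p D)"
    by measurable
  then have "{\<omega>. truncate m (embed_tree \<omega>) = C} \<inter> {\<omega>. P (num_gen n (fst (embed_tree \<omega>)))} \<in> sets (word_space p D)"
    by (intro sets.Int[OF sets_truncate_embed_tree]) simp
  then show ?thesis by (simp add: Collect_conj_eq)
qed

text \<open>Each individual of generation \<open>m\<close> must independently have no descendants
  \<open>j\<close> generations later.\<close>

lemma measure_cylinder_extinct: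
  "measure (word_space p D) {\<omega>. truncate m (embed_tree \<omega>) = C \<and> num_gen (m + j) (fst (embed_tree \<omega>)) = 0} =
    extinct p j ^ num_gen m (fst C) * cyl_prob p D m C"
proof -
  let ?A = "{\<omega>. truncate m (embed_tree \<omega>) = C \<and> num_gen (m + j) (fst (embed_tree \<omega>)) = 0}"
  have "emeasure (word_space p D) ?A = (\<integral>\<^sup>+\<omega>. indicator ?A \<omega> \<partial>word_space p D)"
    using sets_num_gen[of m C "\<lambda>k. k = 0"] by simp
  \<comment> \<open>With \<open>0 ^ 0 = 1\<close>, the power \<open>0 ^ N\<close> is the indicator
    of \<open>N = 0\<close>, so the generating function formula applies at
    \<open>s = 0\<close>.\<close>
  also have "\<dots> = (\<integral>\<^sup>+\<omega>. 0 ^ num_gen (m + j) (fst (embed_tree \<omega>)) *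
       indicator {\<omega>. truncate m (embed_tree \<omega>) = C} \<omega> \<partial>word_space p D)"
    by (intro nn_integral_cong) (auto split: split_indicator)
  also have "\<dots> = ennreal (extinct p j ^ num_gen m (fst C) * cyl_prob p D m C)"
    by (subst nn_integral_power_num_gen)
       (simp add: emeasure_cyl_prob ennreal_mult' ennreal_extinct extinct_nonneg flip: ennreal_power)
  finally show ?thesis
    by (simp add: measure_def extinct_nonneg cyl_prob_def)
qed

lemma measure_cylinder_survive:
  "measure (word_space p D) {\<omega>. truncate m (embed_tree \<omega>) = C \<and> num_gen (m + j) (fst (embed_tree \<omega>)) \<noteq> 0} =
    (1 - extinct p j ^ num_gen m (fst C)) * cyl_prob p D m C"
proof -
  have "cyl_prob p D m C = measure (word_space p D)
     ({\<omega>. truncate m (embed_tree \<omega>) = C \<and> num_gen (m + j) (fst (embed_tree \<omega>)) = 0} \<union>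
      {\<omega>. truncate m (embed_tree \<omega>) = C \<and> num_gen (m + j) (fst (embed_tree \<omega>)) \<noteq> 0})"
    unfolding cyl_prob_def by (rule arg_cong[of _ _ "measure _"]) auto
  also have "\<dots> = extinct p j ^ num_gen m (fst C) * cyl_prob p D m C +
      measure (word_space p D) {\<omega>. truncate m (embed_tree \<omega>) = C \<and> num_gen (m + j) (fst (embed_tree \<omega>)) \<noteq> 0}"
    using sets_num_gen[of m C "\<lambda>k. k = 0"] sets_num_gen[of m C "\<lambda>k. k \<noteq> 0"]
    by (subst word_space.finite_measure_Union) (auto simp: measure_cylinder_extinct)
  finally show ?thesis by (simp add: algebra_simps)
qed

lemma realisations_0_universal:
  obtains C :: "('d::finite) etree" where "C \<in> realisations 0" "\<forall>t\<in>embedded_trees. truncate 0 t = C" "num_gen 0 (fst C) = 1"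
proof -
  let ?t = "embed_tree (\<lambda>_. (0, 0)) :: 'd etree"
  show ?thesis
  proof
    show "truncate 0 ?t \<in> realisations 0" by (simp add: truncate_realisations)
    show "\<forall>t\<in>embedded_trees. truncate 0 t = truncate 0 ?t"
      by (intro ballI truncate_0_eq embed_tree_in_embedded_trees)
    show "num_gen 0 (fst (truncate 0 ?t)) = 1"
      by (simp add: num_gen_truncate fst_embed_tree)
  qed
qed

text \<open>This is the case of depth zero, where the only cylinder is the whole space and
  generation zero has one individual.\<close>

lemma measure_survive:
  fixes D :: "(int ^ 'd::finite) pmf"
  shows
  "measure (word_space p D) {\<omega>. num_gen n (fst (embed_tree \<omega>)) \<noteq> 0} = 1 - extinct p n"
proof -
  obtain C :: "'d etree" where C: "C \<in> realisations 0" "\<forall>t\<in>embedded_trees. truncate 0 t = C" "num_gen 0 (fst C) = 1"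
    by (rule realisations_0_universal)
  then show ?thesis
    using measure_cylinder_survive[of p D 0 C n] word_space.prob_space[of p D]
    by (simp add: cyl_prob_def)
qed

lemma Q_n_eq:
  fixes D :: "(int ^ 'd::finite) pmf"
  shows
  "Q_n p D (m + j) m C =
     (1 - extinct p j ^ num_gen m (fst C)) * cyl_prob p D m C / (1 - extinct p (m + j))"
proof -
  let ?alive = "\<lambda>t. \<exists>i\<in>fst t. generation i = m + j"
  have alive: "?alive t \<longleftrightarrow> num_gen (m + j) (fst t) \<noteq> 0" if "t \<in> embedded_trees" for t :: "'d etree"
    using num_gen_embedded_eq_0_iff[OF that, of "m + j"] by simp
  have "\<P>(t in brw p D. truncate m t = C \<and> ?alive t) = measure (word_space p D)
      {\<omega>. truncate m (embed_tree \<omega>) = C \<and> ?alive (embed_tree \<omega>)}"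
    by (rule measure_brw_Collect[where n = "m + j" and P' = "\<lambda>t. truncate m t = C \<and> ?alive t"])
       (auto simp: fst_truncate)
  moreover have "\<P>(t in brw p D. ?alive t) = measure (word_space p D) {\<omega>. ?alive (embed_tree \<omega>)}"
    by (rule measure_brw_Collect[where n = "m + j" and P' = ?alive]) (auto simp: fst_truncate)
  ultimately show ?thesis
    by (simp add: Q_n_def cond_prob_def alive measure_survive[unfolded neq0_conv]
        measure_cylinder_survive[unfolded neq0_conv])
qed

section \<open>Survival of critical branching processes\<close>

lemma nn_integral_mean:
  fixes p :: "nat pmf"
  assumes "(\<lambda>k. real k * pmf p k) sums 1"
  shows "(\<integral>\<^sup>+k. of_nat k \<partial>p) = 1"
proof -
  have "(\<integral>\<^sup>+k. of_nat k \<partial>p) = (\<Sum>k. ennreal (real k * pmf p k))"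
    unfolding nn_integral_measure_pmf nn_integral_count_space_nat
    by (intro suminf_cong) (simp add: ennreal_of_nat_eq_real_of_nat ennreal_mult mult.commute)
  also have "\<dots> = ennreal 1"
    using assms by (intro suminf_ennreal_eq) auto
  finally show ?thesis by simp
qed

lemma
  fixes p :: "nat pmf"
  assumes "(\<integral>\<^sup>+k. of_nat k \<partial>p) = 1"
  shows integrable_real_pmf: "integrable p real" and integral_real_pmf: "(\<integral>k. real k \<partial>p) = 1"
proof -
  have *: "(\<integral>\<^sup>+k. ennreal (real k) \<partial>p) = 1"
    using assms by (simp add: ennreal_of_nat_eq_real_of_nat)
  then show "integrable p real"
    by (intro integrableI_nonneg) auto
  show "(\<integral>k. real k \<partial>p) = 1"
    using * by (subst integral_eq_nn_integral) auto
qed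

lemma geometric_sum_le: "0 \<le> x \<Longrightarrow> x \<le> 1 \<Longrightarrow> (\<Sum>i<k. x ^ i) \<le> real k"
  using sum_mono[of "{..<k}" "\<lambda>i. x ^ i" "\<lambda>_. 1"] by (simp add: power_le_one)

lemma integrable_power_pmf:
  fixes p :: "nat pmf" and x :: real
  assumes "0 \<le> x" "x \<le> 1" shows "integrable p (\<lambda>k. x ^ k)"
  using assms by (intro measure_pmf.integrable_const_bound[where B = 1]) (auto simp: power_le_one)

context
  fixes p :: "nat pmf"
  assumes mean: "(\<integral>\<^sup>+k. of_nat k \<partial>p) = 1"
begin

lemma integrable_geometric_sum:
  fixes x :: real
  assumes "0 \<le> x" "x \<le> 1" shows "integrable p (\<lambda>k. \<Sum>i<k. x ^ i)"
  using assms geometric_sum_le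
  by (intro Bochner_Integration.integrable_bound[OF integrable_real_pmf[OF mean]])
     (auto simp: sum_nonneg)

text \<open>Factoring \<open>1 - x ^ k\<close> turns the recursion for survival probabilities into a
  multiplicative one. The new factor is at most the mean, hence at most one, since the geometric sum
  is bounded by \<open>k\<close>.\<close>

lemma one_minus_integral_power:
  fixes x :: real
  assumes "0 \<le> x" "x \<le> 1"
  shows "1 - (\<integral>k. x ^ k \<partial>p) = (1 - x) * (\<integral>k. (\<Sum>i<k. x ^ i) \<partial>p)"
proof -
  have "1 - (\<integral>k. x ^ k \<partial>p) = (\<integral>k. 1 - x ^ k \<partial>p)"
    using integrable_power_pmf[OF assms, of p] by simp
  also have "\<dots> = (\<integral>k. (1 - x) * (\<Sum>i<k. x ^ i) \<partial>p)"
    by (simp add: one_diff_power_eq)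
  finally show ?thesis by simp
qed

lemma survival_Suc:
  "1 - extinct p (Suc n) = (1 - extinct p n) * (\<integral>k. (\<Sum>i<k. extinct p n ^ i) \<partial>p)"
  unfolding extinct_Suc by (intro one_minus_integral_power extinct_nonneg extinct_le_1)

lemma extinct_mono: "extinct p n \<le> extinct p (Suc n)"
proof -
  have "(\<integral>k. (\<Sum>i<k. extinct p n ^ i) \<partial>p) \<le> (\<integral>k. real k \<partial>p)"
    by (intro integral_mono integrable_geometric_sum integrable_real_pmf[OF mean]
        extinct_nonneg extinct_le_1 geometric_sum_le)
  then have "1 - extinct p (Suc n) \<le> (1 - extinct p n) * 1"
    unfolding survival_Suc integral_real_pmf[OF mean]
    using extinct_le_1[of p n] by (intro mult_left_mono) auto
  then show ?thesis by simp
qed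

text \<open>The geometric sum contains the term one whenever \<open>k > 0\<close>. Its integral
  could vanish only if there were almost surely no offspring, contradicting mean one.\<close>

lemma extinct_less_1: "extinct p n < 1"
proof (induction n)
  case (Suc n)
  have "0 < (\<integral>k. (\<Sum>i<k. extinct p n ^ i) \<partial>p)"
  proof -
    have "0 \<le> (\<integral>k. (\<Sum>i<k. extinct p n ^ i) \<partial>p)"
      by (intro Bochner_Integration.integral_nonneg) (auto simp: sum_nonneg extinct_nonneg)
    moreover have "(\<integral>k. (\<Sum>i<k. extinct p n ^ i) \<partial>p) \<noteq> 0"
    proof
      assume "(\<integral>k. (\<Sum>i<k. extinct p n ^ i) \<partial>p) = 0"
      then have "AE k in p. (\<Sum>i<k. extinct p n ^ i) = 0"
        by (subst (asm) integral_nonneg_eq_0_iff_AE)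
           (auto simp: sum_nonneg extinct_nonneg integrable_geometric_sum extinct_le_1)
      then have "AE k in p. real k = 0"
      proof (rule AE_mp, intro AE_I2 impI)
        fix k assume "(\<Sum>i<k. extinct p n ^ i) = 0"
        then have "\<forall>i<k. extinct p n ^ i = 0"
          by (subst (asm) sum_nonneg_eq_0_iff) (auto simp: extinct_nonneg)
        then show "real k = 0" by (cases k) auto
      qed
      then have "(\<integral>k. real k \<partial>p) = 0" by (rule integral_eq_zero_AE)
      then show False by (simp add: integral_real_pmf[OF mean])
    qed
    ultimately show ?thesis by simp
  qed
  then have "0 < 1 - extinct p (Suc n)"
    unfolding survival_Suc using Suc by (intro mult_pos_pos) auto
  then show ?case by simp
qed simp

text \<open>The monotone limit \<open>L\<close> is a fixed point of the generating function. If
  \<open>L < 1\<close>, the geometric sum in \<open>L\<close> has the same mean as its upper bound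
  \<open>k\<close>, so the two agree almost surely. For \<open>k\<close> at least two the term with
  \<open>i = 1\<close> makes the bound strict, so \<open>k\<close> is at most one, and mean one
  forces \<open>pmf p 1 = 1\<close>.\<close>

lemma extinct_tendsto_1:
  assumes "pmf p 1 \<noteq> 1"
  shows "extinct p \<longlonglongrightarrow> 1"
proof -
  obtain L where L: "extinct p \<longlonglongrightarrow> L"
    by (metis incseq_convergent incseq_SucI extinct_mono extinct_le_1)
  have L01: "0 \<le> L" "L \<le> 1"
    using L by (auto intro: LIMSEQ_le_const LIMSEQ_le_const2 simp: extinct_nonneg extinct_le_1)
  have "(\<lambda>n. \<integral>k. extinct p n ^ k \<partial>p) \<longlonglongrightarrow> (\<integral>k. L ^ k \<partial>p)"
    by (rule integral_dominated_convergence[where w = "\<lambda>_. 1"])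
       (auto intro!: tendsto_intros L simp: power_le_one extinct_nonneg extinct_le_1)
  then have "(\<lambda>n. extinct p (Suc n)) \<longlonglongrightarrow> (\<integral>k. L ^ k \<partial>p)"
    by (simp add: extinct_Suc)
  then have fixpoint: "(\<integral>k. L ^ k \<partial>p) = L"
    using LIMSEQ_Suc[OF L] by (rule LIMSEQ_unique)
  have "L = 1"
  proof (rule ccontr)
    assume "L \<noteq> 1"
    with L01 have "L < 1" by simp
    have "1 - L = (1 - L) * (\<integral>k. (\<Sum>i<k. L ^ i) \<partial>p)"
      using one_minus_integral_power[OF L01] fixpoint by simp
    with \<open>L < 1\<close> have "(\<integral>k. (\<Sum>i<k. L ^ i) \<partial>p) = 1" by simp
    then have "(\<integral>k. real k - (\<Sum>i<k. L ^ i) \<partial>p) = 0"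
      using integrable_geometric_sum[OF L01]
      by (simp add: integral_real_pmf[OF mean] integrable_real_pmf[OF mean])
    then have "AE k in p. real k - (\<Sum>i<k. L ^ i) = 0"
      by (subst (asm) integral_nonneg_eq_0_iff_AE)
         (auto simp: geometric_sum_le L01 integrable_geometric_sum integrable_real_pmf[OF mean])
    then have "AE k in p. real k = indicator {1} k"
    proof (rule AE_mp, intro AE_I2 impI)
      fix k assume k: "real k - (\<Sum>i<k. L ^ i) = 0"
      have "k < 2"
      proof (rule ccontr)
        assume "\<not> k < 2"
        have "(\<Sum>i<k. L ^ i) < (\<Sum>i<k. 1)"
        proof (rule sum_strict_mono_ex1)
          show "\<exists>i\<in>{..<k}. L ^ i < 1" using \<open>\<not> k < 2\<close> \<open>L < 1\<close> by (intro bexI[of _ 1]) auto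
        qed (auto simp: power_le_one L01)
        with k show False by simp
      qed
      then show "real k = indicator {1} k" by (auto simp: less_2_cases_iff)
    qed
    then have "(\<integral>k. real k \<partial>p) = (\<integral>k. indicator {1} k \<partial>p)"
      by (intro integral_cong_AE) auto
    also have "\<dots> = pmf p 1" by (simp add: pmf.rep_eq)
    finally show False using assms by (simp add: integral_real_pmf[OF mean])
  qed
  with L show ?thesis by simp
qed

text \<open>Successive survival probabilities have as ratio the integral of the geometric sum. It
  tends to the mean by dominated convergence with bound \<open>k\<close>, and the general ratio is a
  product of \<open>m\<close> such factors.\<close>

lemma survival_ratio_tendsto:
  assumes "pmf p 1 \<noteq> 1"
  shows "(\<lambda>j. (1 - extinct p (m + j)) / (1 - extinct p j)) \<longlonglongrightarrow> 1"
proof (induction m)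
  case 0
  have "(\<lambda>j. (1 - extinct p (0 + j)) / (1 - extinct p j)) = (\<lambda>_. 1)"
    using extinct_less_1 by (auto simp: less_le)
  then show ?case by simp
next
  case (Suc m)
  have "(\<lambda>n. \<Sum>i<k. extinct p n ^ i) \<longlonglongrightarrow> (\<Sum>i<k. 1 ^ i)" for k
    by (intro tendsto_intros extinct_tendsto_1[OF assms])
  then have "(\<lambda>n. \<integral>k. (\<Sum>i<k. extinct p n ^ i) \<partial>p) \<longlonglongrightarrow> (\<integral>k. (\<Sum>i<k. 1 ^ i) \<partial>p)"
    by (intro integral_dominated_convergence[where w = real])
       (auto intro!: integrable_real_pmf[OF mean] geometric_sum_le
         simp: sum_nonneg extinct_nonneg extinct_le_1)
  then have "(\<lambda>n. \<integral>k. (\<Sum>i<k. extinct p n ^ i) \<partial>p) \<longlonglongrightarrow> 1"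
    by (simp add: integral_real_pmf[OF mean])
  then have "(\<lambda>j. \<integral>k. (\<Sum>i<k. extinct p (j + m) ^ i) \<partial>p) \<longlonglongrightarrow> 1"
    by (rule LIMSEQ_ignore_initial_segment)
  from tendsto_mult[OF this Suc] show ?case
    using survival_Suc[of "m + j" for j] by (simp add: add.commute mult.commute)
qed

text \<open>The numerator is \<open>1 - extinct p j\<close> times a geometric sum with
  \<open>N\<close> terms, each tending to one; the shift by \<open>m\<close> in the denominator is
  asymptotically invisible.\<close>

lemma survival_power_ratio_tendsto:
  assumes "pmf p 1 \<noteq> 1"
  shows "(\<lambda>j. (1 - extinct p j ^ N) / (1 - extinct p (m + j))) \<longlonglongrightarrow> real N"
proof -
  have "(\<lambda>j. (\<Sum>i<N. extinct p j ^ i) / ((1 - extinct p (m + j)) / (1 - extinct p j)))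
      \<longlonglongrightarrow> (\<Sum>i<N. 1 ^ i) / 1"
    by (intro tendsto_intros extinct_tendsto_1[OF assms] survival_ratio_tendsto[OF assms]) simp
  then show ?thesis
    by (simp add: one_diff_power_eq mult.commute)
qed

end

text \<open>With exactly one child each, the generating function is the identity and its iterates
  stay at zero. This is the critical case where survival probabilities do not decay.\<close>

lemma extinct_degenerate:
  assumes "pmf p 1 = 1" shows "extinct p n = 0"
proof -
  have "set_pmf p \<subseteq> {1}"
    using assms measure_pmf.prob_eq_1[of "{1}" p] by (auto simp: pmf.rep_eq AE_measure_pmf_iff)
  then have AE: "AE k in p. extinct p n ^ k = extinct p n" for n
    by (auto simp: AE_measure_pmf_iff)
  show ?thesis
  proof (induction n)
    case (Suc n)
    have "extinct p (Suc n) = (\<integral>k. extinct p n \<partial>p)"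
      unfolding extinct_Suc using AE by (intro integral_cong_AE) auto
    with Suc show ?case by simp
  qed simp
qed

lemma num_gen_degenerate:
  assumes "pmf p 1 = 1" and "cyl_prob p D m C \<noteq> 0"
  shows "num_gen m (fst C) = 1"
proof -
  have "set_pmf p \<subseteq> {1}"
    using assms(1) measure_pmf.prob_eq_1[of "{1}" p] by (auto simp: pmf.rep_eq AE_measure_pmf_iff)
  then have "AE x in pair_pmf p D. fst x = 1"
    by (auto simp: AE_measure_pmf_iff)
  then have "AE \<omega> in word_space p D. fst (\<omega> i) = 1" for i
    unfolding word_space_def
    by (rule AE_PiM_component[rotated 2]) (auto intro: measure_pmf.prob_space_axioms)
  then have AE: "AE \<omega> in word_space p D. \<forall>i. fst (\<omega> i) = 1"
    by (simp add: AE_all_countable)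
  \<comment> \<open>A cylinder of positive probability meets the almost sure event of one child
    everywhere, and a single common sample point determines the tree.\<close>
  have "\<exists>\<omega>. (\<forall>i. fst (\<omega> i) = 1) \<and> truncate m (embed_tree \<omega>) = C"
  proof (rule ccontr)
    assume "\<nexists>\<omega>. (\<forall>i. fst (\<omega> i) = 1) \<and> truncate m (embed_tree \<omega>) = C"
    then have "AE \<omega> in word_space p D. \<omega> \<notin> {\<omega>. truncate m (embed_tree \<omega>) = C}"
      by (intro eventually_mono[OF AE]) blast
    then have "cyl_prob p D m C = 0"
      unfolding cyl_prob_def using sets_truncate_embed_tree[of m C p D]
      by (subst word_space.prob_eq_0) auto
    with assms show False by simp
  qed
  then obtain \<omega> where \<omega>: "\<And>i. fst (\<omega> i) = 1" "truncate m (embed_tree \<omega>) = C" by blast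
  have "num_gen n (family_tree (\<lambda>_. 1)) = 1" for n
  proof (induction n)
    case (Suc n)
    then show ?case by (simp add: num_gen_Suc) (simp add: num_gen_def)
  qed simp
  then show ?thesis
    using num_gen_truncate[of m m "embed_tree \<omega>"] \<omega> by (simp add: fst_embed_tree)
qed

lemma Q_n_tendsto:
  fixes p :: "nat pmf"
  assumes mean: "(\<integral>\<^sup>+k. of_nat k \<partial>p) = 1"
  shows "(\<lambda>n. Q_n p D n m C) \<longlonglongrightarrow> real (num_gen m (fst C)) * cyl_prob p D m C"
proof -
  have "(\<lambda>j. Q_n p D (m + j) m C) \<longlonglongrightarrow> real (num_gen m (fst C)) * cyl_prob p D m C"
  proof (cases "pmf p 1 = 1")
    case True
    \<comment> \<open>Nothing dies out, so the formula reads \<open>1 - 0 ^ N\<close> times the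
      cylinder probability; either that probability is zero or \<open>N\<close> is one.\<close>
    then have "Q_n p D (m + j) m C = real (num_gen m (fst C)) * cyl_prob p D m C" for j
      using num_gen_degenerate[OF True, of D m C]
      by (cases "cyl_prob p D m C = 0") (simp_all add: Q_n_eq extinct_degenerate)
    then show ?thesis by simp
  next
    case False
    show ?thesis
      using tendsto_mult[OF survival_power_ratio_tendsto[OF mean False]
          tendsto_const[of "cyl_prob p D m C"]]
      by (simp add: Q_n_eq)
  qed
  then show ?thesis
    using LIMSEQ_offset[of "\<lambda>n. Q_n p D n m C" m] by (simp add: add.commute)
qed

lemma P_n_tendsto:
  fixes p :: "nat pmf"
  assumes "(\<integral>\<^sup>+k. of_nat k \<partial>p) = 1"
  shows "(\<lambda>n. P_n p D n m C) \<longlonglongrightarrow> real (num_gen m (fst C)) * cyl_prob p D m C"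
  by (intro tendsto_eventually eventually_sequentiallyI[of m]) (simp add: P_n_eq[OF _ assms])

section \<open>Projective limits of discrete distributions\<close>

text \<open>The process is driven by independent random maps: attached to every pair of a level \<open>n\<close> and a
  point \<open>c\<close> of that level is a random point above \<open>c\<close> with the conditional law of level \<open>Suc n\<close>
  given \<open>c\<close>. A default choice of a point above \<open>c\<close> makes the consistency hold everywhere and not
  only almost surely. Each event that the process is at a given point is then a finite-dimensional
  box, whose probability telescopes.\<close>

lemma discrete_projective_limit:
  fixes \<mu> :: "nat \<Rightarrow> 'a pmf" and r :: "nat \<Rightarrow> 'a \<Rightarrow> 'a"
  assumes consistent: "\<And>n. map_pmf (r n) (\<mu> (Suc n)) = \<mu> n"
    and supp: "\<And>n. set_pmf (\<mu> n) \<subseteq> R n"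
    and r_R: "\<And>n c. c \<in> R (Suc n) \<Longrightarrow> r n c \<in> R n"
    and ext: "\<And>n c. c \<in> R n \<Longrightarrow> \<exists>c'\<in>R (Suc n). r n c' = c"
    and base: "R 0 = {c0}"
  obtains M :: "(nat \<times> 'a \<Rightarrow> 'a) measure" and X where
    "prob_space M"
    "\<forall>n \<omega>. X n \<omega> \<in> R n"
    "\<forall>n \<omega>. r n (X (Suc n) \<omega>) = X n \<omega>"
    "\<forall>n. \<forall>c\<in>R n. {\<omega> \<in> space M. X n \<omega> = c} \<in> sets M"
    "\<forall>n. \<forall>c\<in>R n. measure M {\<omega> \<in> space M. X n \<omega> = c} = pmf (\<mu> n) c"
proof -
  define g where "g n c z = (if z \<in> R (Suc n) \<and> r n z = c then z else (SOME z. z \<in> R (Suc n) \<and> r n z = c))"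
    for n c z
  have g: "g n c z \<in> R (Suc n) \<and> r n (g n c z) = c" if "c \<in> R n" for n c z
    using someI_ex[of "\<lambda>z. z \<in> R (Suc n) \<and> r n z = c"] ext[OF that] unfolding g_def by auto
  define X where "X n \<omega> = rec_nat c0 (\<lambda>n c. g n c (\<omega> (n, c))) n" for n \<omega>
  have X_0: "X 0 \<omega> = c0" and X_Suc: "X (Suc n) \<omega> = g n (X n \<omega>) (\<omega> (n, X n \<omega>))" for n \<omega>
    by (simp_all add: X_def)
  have X_R: "X n \<omega> \<in> R n" for n \<omega>
    by (induction n) (use base g in \<open>auto simp: X_0 X_Suc\<close>)
  have X_r: "r n (X (Suc n) \<omega>) = X n \<omega>" for n \<omega>
    using g[OF X_R] by (simp add: X_Suc)
  \<comment> \<open>Conditioning requires positive mass. At a point of mass zero a point mass fills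
    the gap; both sides of \<open>K_prob\<close> vanish there.\<close>
  define K where "K = (\<lambda>(n, c). if c \<in> set_pmf (\<mu> n) then cond_pmf (\<mu> (Suc n)) (r n -` {c}) else return_pmf c)"
  define M where "M = Pi\<^sub>M UNIV (\<lambda>i. measure_pmf (K i))"
  interpret product_prob_space "\<lambda>i. measure_pmf (K i)" UNIV by standard
  have space_M: "space M = UNIV" by (simp add: M_def space_PiM)
  have "prob_space M" unfolding M_def by (rule P.prob_space_axioms)

  have K_prob: "pmf (\<mu> n) c * measure (K (n, c)) {z. g n c z = c'} = pmf (\<mu> (Suc n)) c'"
    if c': "c' \<in> R (Suc n)" and c: "r n c' = c" for n c c'
  proof (cases "c \<in> set_pmf (\<mu> n)")
    case True
    have nonempty: "set_pmf (\<mu> (Suc n)) \<inter> r n -` {c} \<noteq> {}"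
      using True unfolding consistent[of n, symmetric] by auto
    \<comment> \<open>A sample of the conditional law lies almost surely above \<open>c\<close>, so
      \<open>g\<close> leaves it unchanged.\<close>
    have "measure (K (n, c)) {z. g n c z = c'} = measure (K (n, c)) {c'}"
    proof (rule measure_pmf.finite_measure_eq_AE)
      show "AE z in K (n, c). z \<in> {z. g n c z = c'} \<longleftrightarrow> z \<in> {c'}"
        using True supp[of "Suc n"] by (auto simp: AE_measure_pmf_iff K_def set_cond_pmf[OF nonempty] g_def)
    qed auto
    also have "\<dots> = pmf (\<mu> (Suc n)) c' / measure (\<mu> (Suc n)) (r n -` {c})"
      using True c by (simp add: K_def pmf_cond[OF nonempty] measure_pmf_single)
    also have "measure (\<mu> (Suc n)) (r n -` {c}) = pmf (\<mu> n) c"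
      unfolding consistent[of n, symmetric] by (rule pmf_map[symmetric])
    finally show ?thesis using True by (simp add: set_pmf_iff)
  next
    case False
    have "c' \<notin> set_pmf (\<mu> (Suc n))"
      using False c unfolding consistent[of n, symmetric] by auto
    with False show ?thesis by (simp add: set_pmf_iff)
  qed

  \<comment> \<open>The projections of \<open>c\<close> to all lower levels, listed from level zero
    upwards.\<close>
  have path: "\<exists>y. y n = c \<and> (\<forall>k\<le>n. y k \<in> R k) \<and> (\<forall>k<n. r k (y (Suc k)) = y k)" if "c \<in> R n" for n c
    using that
  proof (induction n arbitrary: c)
    case 0
    then show ?case by (intro exI[of _ "\<lambda>_. c"]) simp
  next
    case (Suc n)
    then obtain y where "y n = r n c" "\<forall>k\<le>n. y k \<in> R k" "\<forall>k<n. r k (y (Suc k)) = y k"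
      using r_R by blast
    with Suc.prems show ?case
      by (intro exI[of _ "y(Suc n := c)"]) (auto simp: less_Suc_eq le_Suc_eq)
  qed

  have X_eq: "{\<omega> \<in> space M. X n \<omega> = c} \<in> sets M \<and> measure M {\<omega> \<in> space M. X n \<omega> = c} = pmf (\<mu> n) c"
    if cR: "c \<in> R n" for n c
  proof -
    obtain y where y: "y n = c" "\<And>k. k \<le> n \<Longrightarrow> y k \<in> R k" "\<And>k. k < n \<Longrightarrow> r k (y (Suc k)) = y k"
      using path[OF cR] by blast
    define A where "A i = {z. g (fst i) (snd i) z = y (Suc (fst i))}" for i
    \<comment> \<open>While the process follows the path \<open>y\<close>, level \<open>k\<close>
      reads only the coordinate \<open>(k, y k)\<close>. Different levels read different
      coordinates, so the conditions are independent.\<close>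
    have X_iff: "X j \<omega> = y j \<longleftrightarrow> (\<forall>k<j. \<omega> (k, y k) \<in> A (k, y k))" if "j \<le> n" for j \<omega>
      using that
    proof (induction j)
      case 0
      then show ?case using y(2)[of 0] base by (simp add: X_0)
    next
      case (Suc j)
      have "X (Suc j) \<omega> = y (Suc j) \<longleftrightarrow> X j \<omega> = y j \<and> g j (y j) (\<omega> (j, y j)) = y (Suc j)"
        using Suc.prems X_r[of j \<omega>] y(3)[of j] X_Suc[of j \<omega>] by force
      with Suc show ?case by (auto simp: A_def less_Suc_eq)
    qed
    let ?J = "(\<lambda>k. (k, y k)) ` {..<n}"
    have eq: "{\<omega> \<in> space M. X n \<omega> = c} = {\<omega> \<in> space M. \<forall>i\<in>?J. \<omega> i \<in> A i}"
      using X_iff[of n] y(1) by auto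
    also have "\<dots> = prod_emb UNIV (\<lambda>i. measure_pmf (K i)) ?J (Pi\<^sub>E ?J A)"
      by (auto simp: prod_emb_def M_def space_PiM Pi_iff)
    also have "\<dots> \<in> sets M"
      unfolding M_def by (intro sets_PiM_I) auto
    finally have sets: "{\<omega> \<in> space M. X n \<omega> = c} \<in> sets M" .
    have prod_eq: "(\<Prod>k<j. measure (K (k, y k)) (A (k, y k))) = pmf (\<mu> j) (y j)" if "j \<le> n" for j
      using that
    proof (induction j)
      case 0
      have "set_pmf (\<mu> 0) \<subseteq> {y 0}"
        using supp[of 0] base y(2)[of 0] by auto
      then show ?case by (simp add: set_pmf_subset_singleton)
    next
      case (Suc j)
      then show ?case
        using K_prob[of "y (Suc j)" j "y j"] y(2)[of "Suc j"] y(3)[of j] by (simp add: A_def)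
    qed
    have "emeasure M {\<omega> \<in> space M. X n \<omega> = c} = (\<Prod>i\<in>?J. emeasure (K i) (A i))"
      unfolding eq unfolding M_def by (rule emeasure_PiM_Collect) auto
    also have "\<dots> = (\<Prod>k<n. emeasure (K (k, y k)) (A (k, y k)))"
      by (subst prod.reindex) (auto simp: inj_on_def)
    also have "\<dots> = ennreal (\<Prod>k<n. measure (K (k, y k)) (A (k, y k)))"
      by (simp add: measure_pmf.emeasure_eq_measure prod_ennreal)
    also have "\<dots> = ennreal (pmf (\<mu> n) c)"
      using prod_eq[of n] y(1) by simp
    finally have "measure M {\<omega> \<in> space M. X n \<omega> = c} = pmf (\<mu> n) c"
      by (simp add: measure_def)
    with sets show ?thesis ..
  qed
  show ?thesis
    by (rule that[of M X]) (use \<open>prob_space M\<close> X_R X_r X_eq in simp_all)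
qed

section \<open>The limit measure\<close>

text \<open>The size-biased law that is the value of both limits.\<close>

definition biased_prob :: "nat pmf \<Rightarrow> (int ^ 'd) pmf \<Rightarrow> nat \<Rightarrow> ('d::finite) etree \<Rightarrow> real" where
  "biased_prob p D m C = real (num_gen m (fst C)) * cyl_prob p D m C"

lemma biased_prob_nonneg: "0 \<le> biased_prob p D m C"
  by (simp add: biased_prob_def cyl_prob_def)

text \<open>Consistency of the biased weights: by the martingale property both sides integrate the
  size of generation \<open>n\<close> over the cylinder of \<open>C\<close>.\<close>

lemma sum_biased_prob:
  assumes mean: "(\<integral>\<^sup>+k. of_nat k \<partial>measure_pmf p) = 1" and "m \<le> n"
  shows "(\<integral>\<^sup>+C'. biased_prob p D n C' \<partial>count_space {C' \<in> realisations n. truncate m C' = C}) = biased_prob p D m C"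
proof -
  have *: "(\<integral>\<^sup>+\<omega>. of_nat (num_gen n (fst (embed_tree \<omega>))) * indicator {\<omega>. truncate k (embed_tree \<omega>) = C} \<omega> \<partial>word_space p D)
    = biased_prob p D k C" if "k \<le> n" for k C
    using nn_integral_num_gen[OF mean, where m = k and j = "n - k" and D = D and C = C] that
    by (simp add: biased_prob_def emeasure_cyl_prob ennreal_mult' ennreal_of_nat_eq_real_of_nat)
  show ?thesis
    using nn_integral_cylinder_sum[OF \<open>m \<le> n\<close>, of "\<lambda>\<omega>. of_nat (num_gen n (fst (embed_tree \<omega>)))" p D C]
    by (simp add: * \<open>m \<le> n\<close>)
qed

definition biased_pmf :: "nat pmf \<Rightarrow> (int ^ 'd) pmf \<Rightarrow> nat \<Rightarrow> ('d::finite) etree pmf" where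
  "biased_pmf p D m = embed_pmf (\<lambda>C. if C \<in> realisations m then biased_prob p D m C else 0)"

context
  fixes p :: "nat pmf"
  assumes mean: "(\<integral>\<^sup>+k. of_nat k \<partial>measure_pmf p) = 1"
begin

lemma pmf_biased_pmf:
  fixes C :: "('d::finite) etree"
  shows "pmf (biased_pmf p D m) C = (if C \<in> realisations m then biased_prob p D m C else 0)"
  unfolding biased_pmf_def
proof (rule pmf_embed_pmf)
  obtain C0 :: "'d etree" where C0: "C0 \<in> realisations 0" "\<forall>t\<in>embedded_trees. truncate 0 t = C0"
      "num_gen 0 (fst C0) = 1"
    by (rule realisations_0_universal)
  \<comment> \<open>Every realisation refines the only one of depth zero, so total mass one is an
    instance of consistency.\<close>
  have R: "realisations m = {C \<in> realisations m. truncate 0 C = C0}"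
    using C0 by (auto simp: realisations_iff)
  have "(\<integral>\<^sup>+C. ennreal (if C \<in> realisations m then biased_prob p D m C else 0) \<partial>count_space UNIV) =
      (\<integral>\<^sup>+C. biased_prob p D m C \<partial>count_space (realisations m))"
    by (subst nn_integral_count_space_indicator)
       (auto intro!: nn_integral_cong split: split_indicator)
  also have "\<dots> = biased_prob p D 0 C0"
    by (subst R) (rule sum_biased_prob[OF mean], simp)
  also have "\<dots> = 1"
    using C0 word_space.prob_space[of p D] by (simp add: biased_prob_def cyl_prob_def)
  finally show "(\<integral>\<^sup>+C. ennreal (if C \<in> realisations m then biased_prob p D m C else 0) \<partial>count_space UNIV) = 1" .
qed (simp add: biased_prob_nonneg)

lemma set_biased_pmf: "set_pmf (biased_pmf p D m) \<subseteq> realisations m"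
  by (auto simp: set_pmf_iff pmf_biased_pmf split: if_splits)

lemma map_truncate_biased_pmf:
  fixes D :: "(int ^ 'd::finite) pmf"
  shows "map_pmf (truncate m) (biased_pmf p D (Suc m)) = biased_pmf p D m"
proof (rule pmf_eqI)
  fix C :: "'d etree"
  let ?A = "{C' \<in> realisations (Suc m). truncate m C' = C}"
  have "ennreal (pmf (map_pmf (truncate m) (biased_pmf p D (Suc m))) C) = emeasure (biased_pmf p D (Suc m)) (truncate m -` {C})"
    by (simp add: pmf_map measure_pmf.emeasure_eq_measure)
  also have "\<dots> = emeasure (biased_pmf p D (Suc m)) ?A"
    using set_biased_pmf by (intro emeasure_eq_AE) (auto simp: AE_measure_pmf_iff)
  also have "\<dots> = (\<integral>\<^sup>+C'. pmf (biased_pmf p D (Suc m)) C' \<partial>count_space ?A)"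
    by (rule nn_integral_pmf[symmetric])
  also have "\<dots> = (\<integral>\<^sup>+C'. biased_prob p D (Suc m) C' \<partial>count_space ?A)"
    by (intro nn_integral_cong) (simp add: pmf_biased_pmf)
  also have "\<dots> = (if C \<in> realisations m then biased_prob p D m C else 0)"
  proof (cases "C \<in> realisations m")
    case False
    then have "?A = {}" by (auto simp: realisations_iff)
    with False show ?thesis by (simp only:) (simp add: nn_integral_empty)
  qed (simp add: sum_biased_prob[OF mean])
  also have "\<dots> = pmf (biased_pmf p D m) C"
    by (simp add: pmf_biased_pmf)
  finally show "pmf (map_pmf (truncate m) (biased_pmf p D (Suc m))) C = pmf (biased_pmf p D m) C"
    by simp
qed

end

text \<open>The trees increase and glue to their union. Hence a consistent random sequence yields a
  point of \<open>embedded_trees\<close> for every outcome, with no exceptional set.\<close>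

lemma consistent_realisations:
  fixes C :: "nat \<Rightarrow> ('d::finite) etree"
  assumes C: "\<And>m. C m \<in> realisations m" and trunc: "\<And>m. truncate m (C (Suc m)) = C m"
  shows "\<exists>t\<in>embedded_trees. \<forall>m. truncate m t = C m"
proof -
  have trunc_le: "truncate m (C n) = C m" if "m \<le> n" for m n
    using that
  proof (induction n rule: dec_induct)
    case base
    show ?case using C[of m] by (simp add: realisations_iff)
  next
    case (step n)
    have "truncate m (C (Suc n)) = truncate m (truncate n (C (Suc n)))"
      using step by (simp add: min_absorb1 del: trunc)
    also have "\<dots> = C m" using step by (simp add: trunc)
    finally show ?case .
  qed
  define T where "T = (\<Union>m. fst (C m))"
  define t where "t = (T, restrict (\<lambda>i. snd (C (generation i)) i) T)"
  have fst_C: "i \<in> fst (C m) \<longleftrightarrow> i \<in> T \<and> generation i \<le> m" for i m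
  proof
    assume "i \<in> T \<and> generation i \<le> m"
    then obtain n where n: "i \<in> fst (C n)" "generation i \<le> m" by (auto simp: T_def)
    then have "generation i \<le> n" using realisations_generation_le[OF C] by blast
    with n have "i \<in> fst (truncate n (C (max m n)))" "i \<in> fst (truncate m (C (max m n))) \<longleftrightarrow> i \<in> fst (C m)"
      using trunc_le[of n "max m n"] trunc_le[of m "max m n"] by simp_all
    with n show "i \<in> fst (C m)" by (simp add: fst_truncate)
  qed (use realisations_generation_le[OF C] in \<open>auto simp: T_def\<close>)
  have "\<exists>\<xi>. fst (C m) = family_tree \<xi>" "snd (C m) root_word = 0" for m
    using C[of m] by (auto simp: realisations_iff elim!: embedded_treesE)
  then obtain \<xi> where \<xi>: "\<And>m. fst (C m) = family_tree (\<xi> m)" by metis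
  \<comment> \<open>The offspring number of \<open>i\<close> is read one level below
    \<open>i\<close>, the first depth at which its children appear.\<close>
  have T: "T = family_tree (\<lambda>i. \<xi> (Suc (generation i)) i)"
  proof (rule family_tree_eqI)
    show "[] \<notin> T" by (auto simp: T_def \<xi>)
    fix i k
    have len: "length i = Suc (generation i)" if "i \<in> T"
      using that by (auto simp: T_def \<xi> length_family_tree)
    have "i @ [k] \<in> T \<longleftrightarrow> i @ [k] \<in> fst (C (length i))"
      by (simp add: fst_C)
    also have "\<dots> \<longleftrightarrow> i = [] \<and> k = 0 \<or> i \<in> fst (C (length i)) \<and> 1 \<le> k \<and> k \<le> \<xi> (length i) i"
      unfolding \<xi> by (rule snoc_mem_family_tree_iff)
    also have "\<dots> \<longleftrightarrow> i = [] \<and> k = 0 \<or> i \<in> T \<and> 1 \<le> k \<and> k \<le> \<xi> (Suc (generation i)) i"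
      using len by (auto simp: fst_C)
    finally show "i @ [k] \<in> T \<longleftrightarrow> i = [] \<and> k = 0 \<or> i \<in> T \<and> 1 \<le> k \<and> k \<le> \<xi> (Suc (generation i)) i" .
  qed
  have root: "root_word \<in> T" unfolding T by (rule family_tree.root)
  have t: "t \<in> embedded_trees"
    using root \<open>\<And>m. snd (C m) root_word = 0\<close>
    by (intro embedded_treesI[of t]) (auto simp: t_def T)
  moreover have "truncate m t = C m" for m
  proof (rule embedded_trees_eqI)
    show "fst (truncate m t) = fst (C m)"
      by (auto simp: fst_truncate fst_C t_def)
    fix i assume "i \<in> fst (truncate m t)"
    then have i: "i \<in> T" "generation i \<le> m" by (auto simp: fst_truncate t_def)
    then have "snd (truncate m t) i = snd (truncate (generation i) (C m)) i"
      by (simp add: snd_truncate t_def trunc_le)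
    also have "\<dots> = snd (C m) i"
      using i by (simp add: snd_truncate fst_C)
    finally show "snd (truncate m t) i = snd (C m) i" .
  qed (use t C in \<open>auto simp: realisations_iff\<close>)
  ultimately show ?thesis by blast
qed

text \<open>The deeper truncation determines the shallower one, so two cylinders are nested or
  disjoint.\<close>

lemma cylinder_Int:
  assumes "m \<le> n" and "C' \<in> realisations n"
  shows "cylinder m C \<inter> cylinder n C' = (if truncate m C' = C then cylinder n C' else {})"
proof -
  have "truncate m t = truncate m C'" if "truncate n t = C'" for t
    using that assms(1) by (auto simp: min_absorb1)
  then show ?thesis by (auto simp: cylinder_def)
qed

lemma prob_with_cylinders_unique:
  fixes \<mu> \<nu> :: "('d::finite) etree measure"
  assumes "prob_with_cylinders F \<mu>" "prob_with_cylinders F \<nu>"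
  shows "\<mu> = \<nu>"
proof -
  interpret \<mu>: prob_space \<mu> using assms by (simp add: prob_with_cylinders_def)
  interpret \<nu>: prob_space \<nu> using assms by (simp add: prob_with_cylinders_def)
  let ?G = "{cylinder m C | m C. C \<in> realisations m} :: 'd etree set set"
  \<comment> \<open>Disjoint cylinders meet in the empty set, which is added to make the generator
    stable under intersection.\<close>
  let ?E = "insert {} ?G"
  have sets: "sets M = sigma_sets embedded_trees ?E" if "sets M = sets etree_space" for M :: "'d etree measure"
  proof -
    have "sigma_sets embedded_trees ?E = sigma_sets embedded_trees ?G"
      by (rule sigma_sets_eqI) (auto intro: sigma_sets.Empty)
    then show ?thesis by (simp only: that sets_etree_space)
  qed
  obtain C0 :: "'d etree" where C0: "C0 \<in> realisations 0" "\<forall>t\<in>embedded_trees. truncate 0 t = C0"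
      "num_gen 0 (fst C0) = 1"
    by (rule realisations_0_universal)
  show ?thesis
  proof (rule measure_eqI_generator_eq_countable[where E = ?E and \<Omega> = embedded_trees and A = "{cylinder 0 C0}"])
    show "Int_stable ?E"
    proof (rule Int_stableI)
      fix A B assume AB: "A \<in> ?E" "B \<in> ?E"
      show "A \<inter> B \<in> ?E"
      proof (cases "A = {} \<or> B = {}")
        case False
        with AB obtain m C n C' where A: "A = cylinder m C" "C \<in> realisations m"
          and B: "B = cylinder n C'" "C' \<in> realisations n" by blast
        have "A \<inter> B = {} \<or> A \<inter> B = A \<or> A \<inter> B = B"
          using cylinder_Int[of m n C' C] cylinder_Int[of n m C C'] A B
          by (cases "m \<le> n") (auto simp: Int_commute split: if_splits)
        with AB show ?thesis by (elim disjE) simp_all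
      qed auto
    qed
    show "?E \<subseteq> Pow embedded_trees" by (auto simp: cylinder_def)
    show "emeasure \<mu> X = emeasure \<nu> X" if "X \<in> ?E" for X
      using that assms unfolding prob_with_cylinders_def \<mu>.emeasure_eq_measure \<nu>.emeasure_eq_measure by auto
    show "sets \<mu> = sigma_sets embedded_trees ?E" "sets \<nu> = sigma_sets embedded_trees ?E"
      by (rule sets, use assms in \<open>simp add: prob_with_cylinders_def\<close>)+
    show "{cylinder 0 C0} \<subseteq> ?E" using C0(1) by blast
    show "\<Union> {cylinder 0 C0} = embedded_trees" using C0(2) by (auto simp: cylinder_def)
  qed auto
qed

lemma prob_with_cylinders_biased_prob:
  fixes D :: "(int ^ 'd::finite) pmf"
  assumes mean: "(\<integral>\<^sup>+k. of_nat k \<partial>measure_pmf p) = 1"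
  shows "\<exists>\<mu>. prob_with_cylinders (biased_prob p D) \<mu>"
proof -
  obtain C0 :: "'d etree" where C0: "C0 \<in> realisations 0" "\<forall>t\<in>embedded_trees. truncate 0 t = C0"
      "num_gen 0 (fst C0) = 1"
    by (rule realisations_0_universal)
  obtain M and X :: "nat \<Rightarrow> (nat \<times> 'd etree \<Rightarrow> 'd etree) \<Rightarrow> 'd etree" where
    "prob_space M"
    and X_R: "\<forall>n \<omega>. X n \<omega> \<in> realisations n"
    and X_trunc: "\<forall>n \<omega>. truncate n (X (Suc n) \<omega>) = X n \<omega>"
    and X_sets: "\<forall>n. \<forall>c\<in>realisations n. {\<omega> \<in> space M. X n \<omega> = c} \<in> sets M"
    and X_prob: "\<forall>n. \<forall>c\<in>realisations n. measure M {\<omega> \<in> space M. X n \<omega> = c} = pmf (biased_pmf p D n) c"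
  proof (rule discrete_projective_limit[of truncate "biased_pmf p D" realisations C0])
    show "map_pmf (truncate n) (biased_pmf p D (Suc n)) = biased_pmf p D n" for n
      by (rule map_truncate_biased_pmf[OF mean])
    show "set_pmf (biased_pmf p D n) \<subseteq> realisations n" for n
      by (rule set_biased_pmf[OF mean])
    show "truncate n C \<in> realisations n" if "C \<in> realisations (Suc n)" for n and C :: "'d etree"
      using that by (auto simp: realisations_iff)
    \<comment> \<open>A realisation of depth \<open>n\<close> is also one of depth
      \<open>Suc n\<close>, with no children in generation \<open>n\<close>, so it extends
      itself.\<close>
    show "\<exists>C'\<in>realisations (Suc n). truncate n C' = C" if "C \<in> realisations n" for n and C :: "'d etree"
      using that realisations_mono[of n "Suc n"] by (intro bexI[of _ C]) (auto simp: realisations_iff)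
    show "realisations 0 = {C0}"
      using C0 by (auto simp: realisations_iff)
  qed blast
  interpret M: prob_space M by fact
  define t where "t \<omega> = (SOME t. t \<in> embedded_trees \<and> (\<forall>m. truncate m t = X m \<omega>))" for \<omega>
  have t: "t \<omega> \<in> embedded_trees \<and> (\<forall>m. truncate m (t \<omega>) = X m \<omega>)" for \<omega>
    unfolding t_def
    by (rule someI_ex) (use consistent_realisations[of "\<lambda>m. X m \<omega>"] X_R X_trunc in blast)
  have t_meas: "t \<in> measurable M etree_space"
    \<comment> \<open>Measurability is tested on truncations, and those of \<open>t\<close> are the
      measurable \<open>X m\<close>, whatever tree the choice operator returns.\<close>
    by (rule measurable_etree_spaceI) (use t X_sets in auto)
  have "prob_with_cylinders (biased_prob p D) (distr M etree_space t)"
    unfolding prob_with_cylinders_def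
  proof (intro conjI allI ballI)
    show "prob_space (distr M etree_space t)"
      by (rule M.prob_space_distr[OF t_meas])
    fix m and C :: "'d etree" assume C: "C \<in> realisations m"
    have "t -` cylinder m C \<inter> space M = {\<omega> \<in> space M. X m \<omega> = C}"
      using t by (auto simp: cylinder_def)
    then show "measure (distr M etree_space t) (cylinder m C) = biased_prob p D m C"
      using C X_prob by (simp add: measure_distr[OF t_meas] cylinder_in_sets pmf_biased_pmf[OF mean])
  qed simp
  then show ?thesis ..
qed

theorem theorem2p1:
  fixes p :: "nat pmf" and D :: "(int ^ 'd::finite) pmf"
  assumes critical: "(\<lambda>m. real m * pmf p m) sums 1"
    and offspring_variance: "summable (\<lambda>m. real m * (real m - 1) * pmf p m)"
    and offspring_third_moment: "summable (\<lambda>m. real m ^ 3 * pmf p m)"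
    and D_symmetric: "\<forall>x. pmf D x = pmf D (- x)"
    and D_variance: "(\<lambda>x. lattice_norm x ^ 2 * pmf D x) summable_on UNIV"
    and D_moment: "\<exists>\<delta>. 0 < \<delta> \<and> \<delta> < 1 \<and>
          (\<lambda>x. lattice_norm x powr (2 + 2 * \<delta>) * pmf D x) summable_on UNIV"
  shows "(\<forall>m. \<forall>C\<in>realisations m.
            convergent (\<lambda>n. P_n p D n m C) \<and> convergent (\<lambda>n. Q_n p D n m C)) \<and>
         (\<exists>!\<mu>. prob_with_cylinders (P_infinity p D) \<mu>) \<and>
         (\<exists>!\<nu>. prob_with_cylinders (Q_infinity p D) \<nu>) \<and>
         (\<forall>\<mu> \<nu>. prob_with_cylinders (P_infinity p D) \<mu> \<longrightarrow> prob_with_cylinders (Q_infinity p D) \<nu>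
            \<longrightarrow> \<mu> = \<nu>)"
proof -
  have mean: "(\<integral>\<^sup>+k. of_nat k \<partial>measure_pmf p) = 1"
    by (rule nn_integral_mean[OF critical])
  have P: "(\<lambda>n. P_n p D n m C) \<longlonglongrightarrow> biased_prob p D m C"
    and Q: "(\<lambda>n. Q_n p D n m C) \<longlonglongrightarrow> biased_prob p D m C" for m C
    unfolding biased_prob_def by (rule P_n_tendsto[OF mean] Q_n_tendsto[OF mean])+
  \<comment> \<open>Both limits are the same function of cylinders, so one existence and uniqueness
    result covers all remaining claims.\<close>
  have "P_infinity p D = biased_prob p D" "Q_infinity p D = biased_prob p D"
    using limI[OF P] limI[OF Q] by (auto simp: fun_eq_iff P_infinity_def Q_infinity_def)
  moreover have "\<exists>!\<mu>. prob_with_cylinders (biased_prob p D) \<mu>"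
    using prob_with_cylinders_biased_prob[OF mean] prob_with_cylinders_unique by (rule ex_ex1I)
  ultimately show ?thesis
    using convergentI[OF P] convergentI[OF Q] prob_with_cylinders_unique[of "biased_prob p D"]
    by simp
qed

end
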